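(* For any augmented group $(G,\chi)$, the sequence $\{\beta_r\}$ of Betti numbers satisfies $\beta_{r+\gamma}=\beta_r$, where $\gamma$ is the cyclotomic order of the $0$th characteristic polynomial $\Delta$ of $(G,\chi)$.
   Context: An augmented group is a pair $(G,\chi)$ where $G$ is a finitely generated group and $\chi:G\to\mathbb{Z}$ is an epimorphism. Let $\mathcal{R}_1=\mathbb{Z}[t,t^{-1}]$. The abelianization $\mathcal{M}$ of $\ker\chi$ is a finitely generated $\mathcal{R}_1$-module, with $t$ acting by conjugation by an element $x\in G$ with $\chi(x)=1$. Write $\mathcal{M}\cong \mathcal{R}_1^N/\mathcal{A}\mathcal{R}_1^M$ with $\mathcal{A}$ an $N\times M$ matrix over $\mathcal{R}_1$, $M\ge N$. The $0$th characteristic polynomial $\Delta$ of $(G,\chi)$ is a generator of the smallest principal ideal of $\mathcal{R}_1$ containing all $N\times N$ minors of $\mathcal{A}$ (that is, a greatest common divisor of these minors); it is well defined up to units of $\mathcal{R}_1$. For a positive integer $r$ put $\mathcal{M}_r=\mathcal{M}/(t^r-1)\mathcal{M}$, a finitely generated abelian group; the Betti number $\beta_r$ is the rank of $\mathcal{M}_r$ as an abelian group. The cyclotomic order $\gamma=\gamma(\Delta)$ is the least common multiple of those positive integers $d$ such that the $d$th cyclotomic polynomial $\Phi_d$ divides $\Delta$; if no cyclotomic polynomial divides $\Delta$ then $\gamma=1$. *)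

theory Defs
  imports
    "HOL-Library.Poly_Mapping"
    "HOL-Algebra.AbelCoset"
    "HOL-Algebra.Elementary_Groups"
    "HOL-Algebra.Generated_Groups"
    "Jordan_Normal_Form.VS_Connect"
    "Jordan_Normal_Form.Char_Poly"
    "Jordan_Normal_Form.DL_Submatrix"
begin

locale augmented_group = group G for G (structure) +
  fixes \<chi> :: "'a \<Rightarrow> int"
  assumes finitely_generated: "\<exists>S. finite S \<and> S \<subseteq> carrier G \<and> generate G S = carrier G"
    and epi: "\<chi> \<in> epi G integer_group"

text \<open>
  The group ring of the integers: the Laurent polynomial ring over the integers in which
  \<^term>\<open>Poly_Mapping.single k 1\<close> is the monomial with exponent \<open>k\<close>. The library provides its
  (convolution) ring structure.
\<close>
type_synonym laurent = "int \<Rightarrow>\<^sub>0 int"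

abbreviation laurent_monom :: "int \<Rightarrow> laurent"
  where "laurent_monom k \<equiv> Poly_Mapping.single k 1"

definition kernel_abelianization ::
  "('g, 'b) monoid_scheme \<Rightarrow> ('g \<Rightarrow> int) \<Rightarrow> 'g set monoid" where
  "kernel_abelianization G \<chi> =
     (let K = kernel G integer_group \<chi> in G\<lparr>carrier := K\<rparr> Mod derived G K)"

definition conj_coset :: "('g, 'b) monoid_scheme \<Rightarrow> 'g \<Rightarrow> 'g set \<Rightarrow> 'g set" where
  "conj_coset G y C = (\<lambda>k. y \<otimes>\<^bsub>G\<^esub> k \<otimes>\<^bsub>G\<^esub> inv\<^bsub>G\<^esub> y) ` C"

text \<open>
  The abelianization of the kernel of \<open>\<chi>\<close>, written additively, as a module over the Laurent
  polynomials: \<open>t\<close> acts by conjugation by \<open>x\<close>, hence the monomial with exponent \<open>i\<close> by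
  conjugation by \<open>x\<close> to the power \<open>i\<close>, and the action is extended linearly. The ring
  multiplication fields of the record are irrelevant for modules.
\<close>
definition augmentation_module ::
  "('g, 'b) monoid_scheme \<Rightarrow> ('g \<Rightarrow> int) \<Rightarrow> 'g \<Rightarrow> (laurent, 'g set) module" where
  "augmentation_module G \<chi> x =
     (let H = kernel_abelianization G \<chi> in
      \<lparr>carrier = carrier H, monoid.mult = undefined, one = undefined,
       zero = \<one>\<^bsub>H\<^esub>, add = monoid.mult H,
       module.smult = (\<lambda>p C. \<Otimes>\<^bsub>H\<^esub>i\<in>Poly_Mapping.keys p.
          conj_coset G (x [^]\<^bsub>G\<^esub> i) C [^]\<^bsub>H\<^esub> Poly_Mapping.lookup p i)\<rparr>)"

text \<open>
  As in the library's quotient ring, the operations are taken elementwise on cosets; in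
  particular \<open>a \<odot> (I +> c) = I +> (a \<odot> c)\<close> when \<open>I\<close> is a submodule.
\<close>
definition quotient_module ::
  "('r, 'm, 'b) module_scheme \<Rightarrow> 'm set \<Rightarrow> ('r, 'm set) module" where
  "quotient_module M I =
     \<lparr>carrier = a_rcosets\<^bsub>M\<^esub> I, monoid.mult = undefined, one = undefined,
      zero = I, add = set_add M,
      module.smult = (\<lambda>a C. \<Union>c\<in>C. I +>\<^bsub>M\<^esub> (a \<odot>\<^bsub>M\<^esub> c))\<rparr>"

definition module_isomorphic ::
  "('r, 'a) ring_scheme \<Rightarrow> ('r, 'm, 'b) module_scheme \<Rightarrow> ('r, 'n, 'c) module_scheme \<Rightarrow> bool" where
  "module_isomorphic R M N \<longleftrightarrow>
     (\<exists>f \<in> LinearCombinations.module_hom R M N. bij_betw f (carrier M) (carrier N))"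

definition cokernel_module :: "nat \<Rightarrow> nat \<Rightarrow> laurent mat \<Rightarrow> (laurent, laurent vec set) module" where
  "cokernel_module N M A =
     quotient_module (module_vec TYPE(laurent) N) ((\<lambda>v. A *\<^sub>v v) ` carrier_vec M)"

definition maximal_minors :: "nat \<Rightarrow> nat \<Rightarrow> 'r :: comm_ring_1 mat \<Rightarrow> 'r set" where
  "maximal_minors N M A = {det (submatrix A {..<N} J) | J. J \<subseteq> {..<M} \<and> card J = N}"

text \<open>
  \<^term>\<open>(dvd) \<Delta>\<close> is membership in the principal ideal generated by \<open>\<Delta>\<close>; the last conjunct says
  that this ideal is contained in every principal ideal containing the minors. The polynomial
  is determined only up to units, so it is specified by a predicate.
\<close>
definition is_characteristic_polynomial ::
  "('g, 'b) monoid_scheme \<Rightarrow> ('g \<Rightarrow> int) \<Rightarrow> 'g \<Rightarrow> laurent \<Rightarrow> bool" where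
  "is_characteristic_polynomial G \<chi> x \<Delta> \<longleftrightarrow>
     (\<exists>N M. \<exists>A \<in> carrier_mat N M.
        N \<le> M \<and>
        module_isomorphic class_ring (augmentation_module G \<chi> x) (cokernel_module N M A) \<and>
        (\<forall>m \<in> maximal_minors N M A. \<Delta> dvd m) \<and>
        (\<forall>c. (\<forall>m \<in> maximal_minors N M A. c dvd m) \<longrightarrow> c dvd \<Delta>))"

definition int_independent :: "('a, 'b) monoid_scheme \<Rightarrow> 'a set \<Rightarrow> bool" where
  "int_independent H S \<longleftrightarrow>
     (\<forall>c :: 'a \<Rightarrow> int. (\<Otimes>\<^bsub>H\<^esub>s\<in>S. s [^]\<^bsub>H\<^esub> c s) = \<one>\<^bsub>H\<^esub> \<longrightarrow> (\<forall>s\<in>S. c s = 0))"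

text \<open>
  The rank of an abelian group, meaningful when it is finite (in particular for finitely
  generated abelian groups).
\<close>
definition ab_group_rank :: "('a, 'b) monoid_scheme \<Rightarrow> nat" where
  "ab_group_rank H = Sup {card S | S. finite S \<and> S \<subseteq> carrier H \<and> int_independent H S}"

definition betti_number ::
  "('g, 'b) monoid_scheme \<Rightarrow> ('g \<Rightarrow> int) \<Rightarrow> 'g \<Rightarrow> nat \<Rightarrow> nat" where
  "betti_number G \<chi> x r =
     (let M = augmentation_module G \<chi> x in
      ab_group_rank (add_monoid (quotient_module M
        ((\<lambda>m. (laurent_monom (int r) - 1) \<odot>\<^bsub>M\<^esub> m) ` carrier M))))"

definition complex_cyclotomic :: "nat \<Rightarrow> complex poly" where
  "complex_cyclotomic d =
     (\<Prod>k | 1 \<le> k \<and> k \<le> d \<and> coprime k d. [:- cis (2 * pi * real k / real d), 1:])"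

text \<open>The integer polynomial whose complexification is the above; existence is part of
  \<open>cyclotomic_complex\<close> below.\<close>
definition cyclotomic :: "nat \<Rightarrow> int poly" where
  "cyclotomic d = (THE p. map_poly of_int p = complex_cyclotomic d)"

lemma complex_cyclotomic_prod:
  assumes n: "n > 0"
  shows "(\<Prod>d | d dvd n. complex_cyclotomic d) = monom 1 n - 1"
proof -
  define z where "z = (\<lambda>k. cis (2 * pi * real k / real n))"
  have bij: "bij_betw z {..<n} {w. w ^ n = 1}"
    unfolding z_def using bij_betw_roots_unity[OF n] by (simp add: mult_ac)
  have z0: "z n = z 0" using n by (simp add: z_def)
  have reidx: "(\<Prod>k\<in>{1..n}. [:- z k, 1:]) = (\<Prod>k\<in>{..<n}. [:- z k, 1:])"
  proof -
    have a: "{1..n} = insert n {1..<n}" "{..<n} = insert 0 {1..<n}" using n by auto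
    show ?thesis unfolding a by (simp add: z0)
  qed
  define P where "P = (\<Prod>k\<in>{..<n}. [:- z k, 1:])"
  have P: "lead_coeff P = 1" "degree P = n"
    unfolding P_def by (simp add: lead_coeff_prod, subst degree_prod_eq_sum_degree, auto)
  have "monom 1 n - P = 1"
  proof (rule poly_eqI_degree)
    fix w :: complex assume "w \<in> {w. w ^ n = 1}"
    then have w1: "w ^ n = 1" and "w \<in> z ` {..<n}" using bij by (auto simp: bij_betw_def)
    then obtain k where "k < n" "w = z k" by auto
    then have "poly P w = 0" unfolding P_def poly_prod by (intro prod_zero) auto
    with w1 show "poly (monom 1 n - P) w = poly 1 w" by (simp add: poly_monom)
  next
    have c: "card {w::complex. w ^ n = 1} = n" using bij_betw_same_card[OF bij] by simp
    show "degree (1::complex poly) < card {w::complex. w ^ n = 1}" using c n by simp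
    have "degree (monom 1 n - P) \<le> n" using P by (intro degree_diff_le) (auto simp: degree_monom_eq)
    moreover have "coeff (monom 1 n - P) n = 0" using P by simp
    ultimately show "degree (monom 1 n - P) < card {w::complex. w ^ n = 1}"
      using n c eq_zero_or_degree_less[of "monom 1 n - P" n] by auto
  qed
  then have P_eq: "P = monom 1 n - 1" by (simp add: algebra_simps)
  have "(\<Prod>d | d dvd n. complex_cyclotomic d) =
        (\<Prod>(d,k)\<in>(SIGMA d:{d. d dvd n}. {k. 1 \<le> k \<and> k \<le> d \<and> coprime k d}).
            [:- cis (2 * pi * real k / real d), 1:])"
    unfolding complex_cyclotomic_def using n by (subst prod.Sigma) auto
  also have "\<dots> = (\<Prod>k\<in>{1..n}. [:- z k, 1:])"
  proof (rule prod.reindex_bij_witness[of _ "\<lambda>m. (n div gcd m n, m div gcd m n)" "\<lambda>(d,k). k * (n div d)"])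
    fix a assume "a \<in> (SIGMA d:{d. d dvd n}. {k. 1 \<le> k \<and> k \<le> d \<and> coprime k d})"
    then obtain d k where a: "a = (d,k)" "d dvd n" "1 \<le> k" "k \<le> d" "coprime k d" by auto
    from a(2) obtain e where e: "n = d * e" by auto
    have pos: "d > 0" "e > 0" using e n by auto
    have g: "gcd (k * e) n = e" using a(5) e gcd_mult_distrib_nat[of e k d] by (simp add: mult.commute)
    show "(n div gcd (case a of (d, k) \<Rightarrow> k * (n div d)) n, (case a of (d, k) \<Rightarrow> k * (n div d)) div gcd (case a of (d, k) \<Rightarrow> k * (n div d)) n) = a"
      using a(1) e pos g by simp
    show "(case a of (d, k) \<Rightarrow> k * (n div d)) \<in> {1..n}" using a e pos by simp
    show "[:- z (case a of (d, k) \<Rightarrow> k * (n div d)), 1:] = (case a of (d, k) \<Rightarrow> [:- cis (2 * pi * real k / real d), 1:])"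
      using a(1) e pos by (simp add: z_def mult.assoc)
  next
    fix m assume m: "m \<in> {1..n}"
    define g where "g = gcd m n"
    have g: "g > 0" "g dvd m" "g dvd n" using m by (auto simp: g_def)
    then obtain a b where ab: "m = g * a" "n = g * b" by (auto elim!: dvdE)
    have "coprime (m div g) (n div g)" using n unfolding g_def by (intro div_gcd_coprime) auto
    then have cop: "coprime a b" using g ab by simp
    show "(case (n div gcd m n, m div gcd m n) of (d, k) \<Rightarrow> k * (n div d)) = m"
      using ab g n unfolding g_def[symmetric] by simp
    show "(n div gcd m n, m div gcd m n) \<in> (SIGMA d:{d. d dvd n}. {k. 1 \<le> k \<and> k \<le> d \<and> coprime k d})"
      using ab g n m cop unfolding g_def[symmetric] by auto
  qed
  also have "\<dots> = monom 1 n - 1" using reidx P_eq P_def by simp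
  finally show ?thesis .
qed

lemma cyclotomic_complex:
  assumes "d > 0"
  shows "map_poly of_int (cyclotomic d) = complex_cyclotomic d"
proof -
  have lc: "lead_coeff (complex_cyclotomic d) = 1" for d
    unfolding complex_cyclotomic_def by (simp add: lead_coeff_prod)
  have inj: "p = q" if "map_poly of_int p = (map_poly of_int q :: complex poly)" for p q
    using that by (auto simp: poly_eq_iff coeff_map_poly)
  have "\<exists>p. map_poly of_int p = complex_cyclotomic d" using assms
  proof (induction d rule: less_induct)
    case (less n)
    let ?D = "{d. d dvd n \<and> d \<noteq> n}"
    have fin: "finite ?D" using less.prems by auto
    have "\<forall>d\<in>?D. \<exists>p. map_poly of_int p = complex_cyclotomic d"
    proof
      fix d assume "d \<in> ?D"
      then have "d dvd n" "d \<noteq> n" by auto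
      with less.prems have "d < n" "d > 0" by (auto dest: dvd_imp_le dvd_pos_nat simp: le_neq_implies_less)
      then show "\<exists>p. map_poly of_int p = complex_cyclotomic d" by (rule less.IH)
    qed
    then obtain f where f: "\<forall>d\<in>?D. map_poly of_int (f d) = complex_cyclotomic d" by (rule bchoice[THEN exE])
    define g where "g = (\<Prod>d\<in>?D. f d)"
    let ?h = "map_poly of_int :: int poly \<Rightarrow> complex poly"
    have hg: "?h g = (\<Prod>d\<in>?D. complex_cyclotomic d)"
      unfolding g_def of_int_poly_hom.hom_prod using f by (intro prod.cong) auto
    have lcg': "lead_coeff (?h g) = 1" unfolding hg by (simp add: lead_coeff_prod lc)
    have degh: "degree (?h p) = degree p" for p by simp
    have lcg: "lead_coeff g = 1" using lcg' by (simp add: coeff_map_poly)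
    then have g0: "g \<noteq> 0" by auto
    obtain q r where qr: "pseudo_divmod (monom 1 n - 1) g = (q, r)" by fastforce
    from pseudo_divmod[OF g0 qr] lcg
    have e: "monom 1 n - 1 = g * q + r" and r: "r = 0 \<or> degree r < degree g" by auto
    have "{d. d dvd n} = insert n ?D" by auto
    then have "monom 1 n - 1 = complex_cyclotomic n * ?h g"
      using complex_cyclotomic_prod[OF less.prems] fin hg by simp
    moreover have "?h (monom 1 n - 1) = monom 1 n - 1" by (simp add: hom_distribs)
    ultimately have "complex_cyclotomic n * ?h g = ?h g * ?h q + ?h r"
      using e by (simp only: of_int_poly_hom.hom_add of_int_poly_hom.hom_mult)
    then have k: "?h g * (complex_cyclotomic n - ?h q) = ?h r" by (simp add: algebra_simps)
    have "complex_cyclotomic n - ?h q = 0"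
    proof (rule ccontr)
      assume a: "complex_cyclotomic n - ?h q \<noteq> 0"
      have "?h g \<noteq> 0" using lcg' by auto
      then have "degree (?h r) \<ge> degree (?h g)" "?h r \<noteq> 0"
        using a unfolding k[symmetric] by (simp_all add: degree_mult_eq)
      with r show False by auto
    qed
    then show ?case by auto
  qed
  then have "\<exists>!p. map_poly of_int p = complex_cyclotomic d" using inj by (auto intro!: inj)
  then show ?thesis unfolding cyclotomic_def by (rule theI')
qed

definition laurent_of_poly :: "int poly \<Rightarrow> laurent" where
  "laurent_of_poly p = (\<Sum>i\<le>degree p. Poly_Mapping.single (int i) (coeff p i))"

text \<open>
  If no cyclotomic polynomial divides \<open>\<Delta>\<close>, this is \<open>Lcm {} = 1\<close>. For \<open>\<Delta> = 0\<close> every cyclotomic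
  polynomial divides \<open>\<Delta>\<close>, and the only common multiple of all positive integers is \<open>0\<close>,
  which is the value of \<open>Lcm\<close> on infinite sets; a period of \<open>0\<close> asserts nothing.
\<close>
definition cyclotomic_order :: "laurent \<Rightarrow> nat" where
  "cyclotomic_order \<Delta> = Lcm {d. d > 0 \<and> laurent_of_poly (cyclotomic d) dvd \<Delta>}"

end

theory Submission
  imports Defs "HOL-Number_Theory.Cong"
begin

text \<open>
  Write \<open>M\<close> for the abelianized kernel as a module over the Laurent polynomials, so that the Betti
  number at \<open>r\<close> is the rank of \<open>M/(t^r - 1)M\<close>, and split \<open>t^r - 1 = g * h\<close>, where \<open>g\<close> is the
  product of the cyclotomic polynomials \<open>\<Phi>\<^sub>d\<close> with \<open>d\<close> dividing \<open>r\<close> that divide \<open>\<Delta>\<close>, and \<open>h\<close> is the product of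
  the remaining ones. Each index \<open>d\<close> that contributes to \<open>g\<close> divides the cyclotomic order \<open>\<gamma>\<close>, hence
  divides \<open>r\<close> if and only if it divides \<open>r + \<gamma>\<close>: the factor \<open>g\<close> is the same for \<open>r\<close> and for \<open>r + \<gamma>\<close>.
  It remains to see that the factor \<open>h\<close> does not influence the rank, that is, that
  \<open>M/ghM\<close> and \<open>M/gM\<close> have equal rank (\<open>betti_number_eq\<close>).

  The kernel of \<open>M/ghM \<rightarrow> M/gM\<close> is \<open>gM/ghM\<close>, and a surjection whose kernel is killed by a positive
  integer preserves ranks (\<open>ab_group_rank_eq_of_torsion_kernel\<close>). So a positive integer \<open>n\<close> with
  \<open>nM \<subseteq> hM\<close> is enough, and such integers multiply along products, which reduces the claim to a
  single \<open>\<Phi>\<^sub>d\<close> not dividing \<open>\<Delta>\<close>. As \<open>\<Delta>\<close> is a greatest common divisor of the maximal minors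
  of a presentation matrix \<open>A\<close>, some minor \<open>m\<close> is not divisible by \<open>\<Phi>\<^sub>d\<close>. The adjugate of the
  corresponding square submatrix shows that \<open>m\<close> maps every vector into the range of \<open>A\<close>, so \<open>mM = 0\<close>
  (\<open>maximal_minor_smult_in_range\<close>). Since \<open>\<Phi>\<^sub>d\<close> is irreducible over the rationals, there are \<open>u\<close>, \<open>v\<close>
  with \<open>u \<Phi>\<^sub>d + v m = n\<close> for a positive integer \<open>n\<close> (\<open>laurent_cyclotomic_dvd_or_bezout\<close>), whence
  \<open>nM = u \<Phi>\<^sub>d M \<subseteq> \<Phi>\<^sub>d M\<close>.

  Irreducibility of \<open>\<Phi>\<^sub>d\<close> is used in the form: an integer polynomial vanishing at one primitive \<open>d\<close>-th
  root of unity vanishes at all of them. The argument is Dedekind's, carried out with congruences modulo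
  \<open>p\<close> in the ring of integer polynomials (\<open>int_eval_root_of_unity_prime_power\<close>).
\<close>

section \<open>Integer polynomials and their complex roots\<close>

abbreviation int_eval :: "int poly \<Rightarrow> complex \<Rightarrow> complex" where
  "int_eval p z \<equiv> poly (map_poly of_int p) z"

lemma int_eval_smult: "int_eval (smult c p) z = of_int c * int_eval p z"
  by (simp only: of_int_hom.map_poly_hom_smult poly_smult)

text \<open>
  A nonzero integer polynomial of least degree vanishing at \<open>z\<close>, made primitive, divides every other such
  polynomial up to an integer factor by pseudo-division; by Gauss's lemma that factor can be cancelled.
\<close>
lemma int_minimal_polynomial:
  assumes "P \<noteq> 0" and "int_eval P z = 0"
  obtains f where "f \<noteq> 0" and "int_eval f z = 0" and "\<And>q. int_eval q z = 0 \<Longrightarrow> f dvd q"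
proof -
  define f0 where "f0 = arg_min degree (\<lambda>f. f \<noteq> 0 \<and> int_eval f z = 0)"
  define f where "f = primitive_part f0"
  have f0: "f0 \<noteq> 0 \<and> int_eval f0 z = 0"
    unfolding f0_def by (rule arg_min_natI[of _ P]) (use assms in auto)
  have min: "degree f \<le> degree q" if "q \<noteq> 0" "int_eval q z = 0" for q
    using arg_min_nat_le[of "\<lambda>f. f \<noteq> 0 \<and> int_eval f z = 0" q degree] that
    unfolding f0_def[symmetric] f_def by simp
  have f_nz: "f \<noteq> 0" and f_content: "content f = 1"
    unfolding f_def using f0 by auto
  have "f0 = smult (content f0) f"
    unfolding f_def by (rule content_times_primitive_part[symmetric])
  then have "int_eval f0 z = of_int (content f0) * int_eval f z"
    by (metis int_eval_smult)
  with f0 have f_root: "int_eval f z = 0" by auto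
  show thesis
  proof (rule that[OF f_nz f_root])
    fix q assume q: "int_eval q z = 0"
    obtain s r where sr: "pseudo_divmod q f = (s, r)" by fastforce
    define c where "c = lead_coeff f ^ (Suc (degree q) - degree f)"
    have c: "c \<noteq> 0" using f_nz by (simp add: c_def)
    have eq: "smult c q = f * s + r" and r: "r = 0 \<or> degree r < degree f"
      using pseudo_divmod[OF f_nz sr] by (auto simp: c_def)
    have "int_eval (smult c q) z = int_eval f z * int_eval s z + int_eval r z"
      unfolding eq by (simp only: of_int_poly_hom.hom_add of_int_poly_hom.hom_mult poly_add poly_mult)
    then have "int_eval r z = 0" using f_root q by (simp add: int_eval_smult)
    then have "r = 0" using min[of r] r by linarith
    with eq have eq: "smult c q = f * s" by simp
    \<comment> \<open>Gauss: as \<open>f\<close> is primitive, the constant \<open>c\<close> divides the content of the cofactor \<open>s\<close>.\<close>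
    have "content s = content (smult c q)"
      unfolding eq content_mult using f_content by simp
    then have "c dvd content s" by simp
    then have "[:c:] dvd s" by (simp add: const_poly_dvd_iff_dvd_content)
    then obtain s' where "s = [:c:] * s'" by (rule dvdE)
    with eq have "smult c q = smult c (f * s')" by simp
    with c have "q = f * s'" by (simp only: smult_cancel)
    then show "f dvd q" by simp
  qed
qed

text \<open>
  The ideal generated by \<open>p\<close> and \<open>q\<close> need not be principal over the integers, but an element \<open>h\<close> of least
  degree divides every element up to an integer factor. If \<open>h\<close> were not constant, any complex root of it,
  which exists by the fundamental theorem of algebra, would be a common root of \<open>p\<close> and \<open>q\<close>.
\<close>
lemma int_poly_bezout:
  assumes "p \<noteq> 0" and "\<And>z. int_eval p z = 0 \<Longrightarrow> int_eval q z \<noteq> 0"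
  obtains u v n where "n \<noteq> 0" and "u * p + v * q = [:n:]"
proof -
  define I where "I = (\<lambda>h. \<exists>u v. h = u * p + v * q)"
  have Ip: "I p" unfolding I_def by (rule exI[of _ 1], rule exI[of _ 0]) simp
  have Iq: "I q" unfolding I_def by (rule exI[of _ 0], rule exI[of _ 1]) simp
  define h where "h = arg_min degree (\<lambda>h. h \<noteq> 0 \<and> I h)"
  have h: "h \<noteq> 0 \<and> I h"
    unfolding h_def by (rule arg_min_natI[of _ p]) (use assms Ip in auto)
  then obtain u0 v0 where uv: "h = u0 * p + v0 * q" unfolding I_def by blast
  have min: "degree h \<le> degree g" if "g \<noteq> 0" "I g" for g
    using arg_min_nat_le[of "\<lambda>f. f \<noteq> 0 \<and> I f" g degree] that
    unfolding h_def[symmetric] by simp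
  have root: "int_eval g z = 0" if "I g" and z: "int_eval h z = 0" for g z
  proof -
    obtain s r where sr: "pseudo_divmod g h = (s, r)" by fastforce
    define c where "c = lead_coeff h ^ (Suc (degree g) - degree h)"
    have c: "c \<noteq> 0" using h by (simp add: c_def)
    have eq: "smult c g = h * s + r" and r: "r = 0 \<or> degree r < degree h"
      using pseudo_divmod[OF _ sr] h by (auto simp: c_def)
    obtain u v where g: "g = u * p + v * q" using \<open>I g\<close> unfolding I_def by blast
    have "r = smult c g - h * s" using eq by simp
    also have "\<dots> = (smult c u - u0 * s) * p + (smult c v - v0 * s) * q"
      unfolding g uv by (simp add: algebra_simps smult_add_right)
    finally have "I r" unfolding I_def by blast
    then have "r = 0" using min[of r] r by linarith
    with eq have "smult c g = h * s" by simp
    then have "int_eval (smult c g) z = int_eval h z * int_eval s z"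
      by (simp only: of_int_poly_hom.hom_mult poly_mult)
    with z c show ?thesis by (simp add: int_eval_smult)
  qed
  have "degree h = 0"
  proof (rule ccontr)
    assume "degree h \<noteq> 0"
    then have "\<not> constant (poly (map_poly of_int h :: complex poly))"
      by (simp add: constant_degree)
    then obtain z where "int_eval h z = 0"
      using fundamental_theorem_of_algebra by blast
    with root[OF Ip] root[OF Iq] assms(2) show False by blast
  qed
  then obtain n where "h = [:n:]" by (rule degree_eq_zeroE)
  moreover from this h have "n \<noteq> 0" by auto
  ultimately show thesis using that[of n u0 v0] uv by simp
qed

text \<open>
  The Frobenius identity as a divisibility, which makes sense in rings of characteristic zero such as the
  integer polynomials.
\<close>
lemma prime_dvd_binomial_sum:
  fixes a b :: "'a :: comm_ring_1"
  assumes "prime p"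
  shows "of_nat p dvd (a + b) ^ p - (a ^ p + b ^ p)"
proof -
  have p: "p > 0" using assms by (rule prime_gt_0_nat)
  have split: "{..p} = insert 0 (insert p {0<..<p})" using p by auto
  have "(a + b) ^ p = (\<Sum>k\<le>p. of_nat (p choose k) * a ^ k * b ^ (p - k))"
    by (rule binomial_ring)
  also have "\<dots> = a ^ p + b ^ p + (\<Sum>k\<in>{0<..<p}. of_nat (p choose k) * a ^ k * b ^ (p - k))"
    unfolding split using p by (simp add: algebra_simps)
  finally have eq: "(a + b) ^ p - (a ^ p + b ^ p)
      = (\<Sum>k\<in>{0<..<p}. of_nat (p choose k) * a ^ k * b ^ (p - k))" by simp
  show ?thesis unfolding eq
  proof (rule dvd_sum)
    fix k assume "k \<in> {0<..<p}"
    then have "p dvd (p choose k)" by (intro dvd_choose_prime) (use assms in auto)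
    then have "(of_nat p :: 'a) dvd of_nat (p choose k)" by auto
    then show "(of_nat p :: 'a) dvd of_nat (p choose k) * a ^ k * b ^ (p - k)"
      by (simp add: mult.assoc)
  qed
qed

text \<open>
  Fermat's little theorem for all integers, by induction in both directions from the previous identity.
\<close>
lemma prime_dvd_int_power_diff:
  assumes "prime p" shows "int p dvd c ^ p - c"
proof (induction c rule: int_induct[where k = 0])
  case base
  show ?case using prime_gt_0_nat[OF assms] by (simp add: zero_power)
next
  case (step1 c)
  have "int p dvd ((c + 1) ^ p - (c ^ p + 1 ^ p)) + (c ^ p - c)"
    by (rule dvd_add[OF prime_dvd_binomial_sum[OF assms] step1.IH])
  then show ?case by (simp add: algebra_simps)
next
  case (step2 c)
  have "int p dvd (c ^ p - c) - (((c - 1) + 1) ^ p - ((c - 1) ^ p + 1 ^ p))"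
    by (rule dvd_diff[OF step2.IH prime_dvd_binomial_sum[OF assms]])
  also have "(c ^ p - c) - (((c - 1) + 1) ^ p - ((c - 1) ^ p + 1 ^ p)) = (c - 1) ^ p - (c - 1)"
    by simp
  finally show ?case .
qed

text \<open>
  The congruence \<open>f(X^p) \<equiv> f(X)^p\<close> modulo \<open>p\<close>: Fermat for the coefficients, the Frobenius identity for the sums.
\<close>
lemma prime_dvd_pcompose_monom_diff:
  assumes p: "prime p"
  shows "of_nat p dvd pcompose f (monom 1 p) - (f :: int poly) ^ p"
proof (induction f)
  case 0
  then show ?case using prime_gt_0_nat[OF p] by (simp add: zero_power)
next
  case (pCons a f)
  define X where "X = [:0, 1 :: int:]"
  have X: "monom 1 p = X ^ p" by (simp add: X_def monom_altdef)
  have split: "pCons a f = [:a:] + X * f" by (simp add: X_def)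
  have comp: "pcompose (pCons a f) (X ^ p) = [:a:] + X ^ p * pcompose f (X ^ p)"
    by (simp add: pcompose_pCons)
  have 1: "of_nat p dvd [:a:] ^ p - [:a:]"
    using prime_dvd_int_power_diff[OF p, of a] by (simp add: of_nat_poly poly_const_pow)
  have 2: "of_nat p dvd X ^ p * (pcompose f (X ^ p) - f ^ p)"
    using pCons.IH unfolding X by (rule dvd_mult)
  have 3: "of_nat p dvd pCons a f ^ p - ([:a:] ^ p + (X * f) ^ p)"
    unfolding split by (rule prime_dvd_binomial_sum[OF p])
  have "pcompose (pCons a f) (X ^ p) - pCons a f ^ p
     = X ^ p * (pcompose f (X ^ p) - f ^ p) - ([:a:] ^ p - [:a:])
       - (pCons a f ^ p - ([:a:] ^ p + (X * f) ^ p))"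
    unfolding comp by (simp only: power_mult_distrib algebra_simps)
  then show ?case unfolding X using dvd_diff[OF dvd_diff[OF 2 1] 3] by (simp only:)
qed

section \<open>Irreducibility of the cyclotomic polynomials\<close>

lemma int_eval_pcompose: "int_eval (pcompose p q) z = int_eval p (int_eval q z)"
  by (simp only: of_int_hom.map_poly_pcompose poly_pcompose)

text \<open>
  Dedekind's argument. Let \<open>f\<close> be the minimal polynomial of \<open>w\<close> and \<open>X^n - 1 = f g\<close>. If \<open>f(w^p)\<close> were nonzero,
  then \<open>g(w^p) = 0\<close>, and differentiating gives \<open>n (w^p)^(n-1) = f(w^p) g'(w^p)\<close>. But
  \<open>f(w^p)\<close> is \<open>p\<close> times an integer polynomial in \<open>w\<close>, because \<open>f(X^p)\<close> is congruent to \<open>f(X)^p\<close>. Hence \<open>n\<close> is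
  \<open>p\<close> times an integer polynomial in \<open>w\<close>. Reducing that polynomial modulo \<open>f\<close>, which has unit leading
  coefficient, compares constants and yields \<open>p\<close> dividing \<open>n\<close>.
\<close>
lemma int_eval_root_of_unity_prime_power:
  assumes n: "n > 0" and w: "w ^ n = 1" and m: "int_eval m w = 0"
    and p: "prime p" and pn: "\<not> p dvd n"
  shows "int_eval m (w ^ p) = 0"
proof -
  define P :: "int poly" where "P = monom 1 n - 1"
  have P_eval: "int_eval P z = z ^ n - 1" for z
    unfolding P_def by (simp add: hom_distribs poly_monom)
  have "coeff P n = 1" unfolding P_def using n by simp
  then have P_nz: "P \<noteq> 0" and P_lead: "lead_coeff P = 1"
  proof -
    show "P \<noteq> 0" using \<open>coeff P n = 1\<close> by auto
    have "degree P \<le> n" unfolding P_def by (intro degree_diff_le) (auto simp: degree_monom_eq)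
    moreover have "degree P \<ge> n" using \<open>coeff P n = 1\<close> by (intro le_degree) simp
    ultimately show "lead_coeff P = 1" using \<open>coeff P n = 1\<close> by simp
  qed
  obtain f where f: "f \<noteq> 0" "int_eval f w = 0" and f_min: "\<And>q. int_eval q w = 0 \<Longrightarrow> f dvd q"
    using int_minimal_polynomial[OF P_nz, of w] w P_eval by auto
  obtain g where g: "P = f * g" using f_min[of P] w P_eval by (auto elim: dvdE)
  have "lead_coeff f * lead_coeff g = 1" using P_lead unfolding g lead_coeff_mult .
  then have f_lead: "lead_coeff f dvd 1" by (metis dvd_triv_left)
  have "degree f \<noteq> 0"
  proof
    assume "degree f = 0"
    then obtain c where "f = [:c:]" by (rule degree_eq_zeroE)
    with f show False by simp
  qed
  have "int_eval f (w ^ p) = 0"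
  proof (rule ccontr)
    assume nz: "int_eval f (w ^ p) \<noteq> 0"
    have wp: "(w ^ p) ^ n = 1" using w by (simp flip: power_mult add: mult.commute[of p n]) (simp add: power_mult)
    have "int_eval f (w ^ p) * int_eval g (w ^ p) = int_eval P (w ^ p)"
      unfolding g by (simp only: of_int_poly_hom.hom_mult poly_mult)
    then have g0: "int_eval g (w ^ p) = 0" using nz wp P_eval by simp
    have "int_eval (pderiv P) (w ^ p) = int_eval f (w ^ p) * int_eval (pderiv g) (w ^ p)"
      unfolding g pderiv_mult of_int_poly_hom.hom_add of_int_poly_hom.hom_mult poly_add poly_mult
      using g0 by simp
    moreover have "pderiv P = monom (int n) (n - 1)"
      unfolding P_def by (simp add: pderiv_diff pderiv_monom)
    ultimately have deriv: "of_nat n * (w ^ p) ^ (n - 1) = int_eval f (w ^ p) * int_eval (pderiv g) (w ^ p)"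
      by (simp add: poly_monom)
    obtain h where h: "pcompose f (monom 1 p) - f ^ p = of_nat p * h"
      using prime_dvd_pcompose_monom_diff[OF p] by (rule dvdE)
    then have "pcompose f (monom 1 p) = f ^ p + smult (int p) h"
      by (simp add: of_nat_poly algebra_simps)
    then have "int_eval (pcompose f (monom 1 p)) w = int_eval f w ^ p + of_nat p * int_eval h w"
      by (simp only: of_int_poly_hom.hom_add of_int_poly_hom.hom_power poly_add poly_power int_eval_smult) simp
    then have fp: "int_eval f (w ^ p) = of_nat p * int_eval h w"
      using f(2) prime_gt_0_nat[OF p] by (simp add: int_eval_pcompose poly_monom zero_power)
    define k where "k = monom 1 p * h * pcompose (pderiv g) (monom 1 p)"
    have "of_nat n = of_nat n * (w ^ p) ^ n" using wp by simp
    also have "\<dots> = w ^ p * (of_nat n * (w ^ p) ^ (n - 1))"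
      using n by (cases n) simp_all
    also have "\<dots> = of_nat p * int_eval k w"
      unfolding deriv fp k_def of_int_poly_hom.hom_mult poly_mult int_eval_pcompose
      by (simp add: poly_monom)
    finally have "int_eval ([:int n:] - smult (int p) k) w = 0"
      by (simp only: of_int_poly_hom.hom_minus poly_diff int_eval_smult of_int_hom.map_poly_pCons_hom) simp
    then obtain q where q: "[:int n:] - smult (int p) k = f * q" using f_min by (auto elim: dvdE)
    obtain s r where sr: "pseudo_divmod k f = (s, r)" by fastforce
    define c where "c = lead_coeff f ^ (Suc (degree k) - degree f)"
    have c: "c dvd 1" unfolding c_def is_unit_power_iff using f_lead by (rule disjI1)
    have eq: "smult c k = f * s + r" and r: "r = 0 \<or> degree r < degree f"
      using pseudo_divmod[OF f(1) sr] by (auto simp: c_def)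
    \<comment> \<open>Modulo \<open>f\<close>, the constant \<open>c n\<close> is congruent to \<open>p r\<close>, and \<open>e\<close> has too small a degree to be a nonzero multiple of \<open>f\<close>.\<close>
    define e where "e = [:c * int n:] - smult (int p) r"
    have "e = smult c ([:int n:] - smult (int p) k) + smult (int p) (smult c k - r)"
      unfolding e_def by (simp add: smult_diff_right mult.commute)
    also have "\<dots> = f * (smult c q + smult (int p) s)"
      unfolding q eq by (simp add: algebra_simps)
    finally have fe: "f dvd e" by simp
    have "degree e < degree f"
      unfolding e_def using r \<open>degree f \<noteq> 0\<close>
      by (intro degree_diff_less le_less_trans[OF degree_smult_le]) auto
    with fe have "e = 0" using dvd_imp_degree_le[of f e] by fastforce
    then have "coeff e 0 = 0" by simp
    then have "c * int n = int p * coeff r 0" by (simp add: e_def)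
    then have "int p dvd c * int n" by simp
    then have "int p dvd int n" using c by (simp add: dvd_mult_unit_iff')
    with pn show False by simp
  qed
  moreover obtain q where "m = f * q" using f_min[OF m] by (rule dvdE)
  ultimately show ?thesis by (simp only: of_int_poly_hom.hom_mult poly_mult) simp
qed

text \<open>
  Raising to the power \<open>j\<close> is a succession of raisings to prime exponents, and none of these primes divides \<open>n\<close>.
\<close>
lemma int_eval_root_of_unity_coprime_power:
  assumes n: "n > 0" and w: "w ^ n = 1" and m: "int_eval m w = 0"
    and j: "coprime j n" "j > 0"
  shows "int_eval m (w ^ j) = 0"
  using j
proof (induction j rule: prime_divisors_induct)
  case zero
  then show ?case by simp
next
  case (unit j)
  then show ?case using m by simp
next
  case (factor p j)
  then have "int_eval m (w ^ j) = 0" by auto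
  moreover have "(w ^ j) ^ n = 1" using w by (metis mult.commute power_mult power_one)
  moreover have "\<not> p dvd n"
    using factor.prems(1) factor.hyps by (metis coprime_common_divisor dvd_triv_left not_prime_unit)
  ultimately have "int_eval m ((w ^ j) ^ p) = 0"
    using int_eval_root_of_unity_prime_power[OF n] factor.hyps by blast
  then show ?case by (metis mult.commute power_mult)
qed

lemma prod_linear_factors_dvd:
  fixes q :: "'a :: idom poly"
  assumes "finite S" and "\<And>z. z \<in> S \<Longrightarrow> poly q z = 0"
  shows "(\<Prod>z\<in>S. [:- z, 1:]) dvd q"
  using assms
proof (induction S arbitrary: q rule: finite_induct)
  case (insert a S)
  then obtain q' where q': "q = [:- a, 1:] * q'" by (meson dvdE insertI1 poly_eq_0_iff_dvd)
  have "poly q' z = 0" if "z \<in> S" for z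
    using insert.prems[of z] insert.hyps that unfolding q' by auto
  then have "(\<Prod>z\<in>S. [:- z, 1:]) dvd q'" by (rule insert.IH)
  then show ?case
    unfolding q' prod.insert[OF insert.hyps] by (rule mult_dvd_mono[OF dvd_refl])
qed simp

definition root_of_unity :: "nat \<Rightarrow> nat \<Rightarrow> complex" where
  "root_of_unity d k = cis (2 * pi * real k / real d)"

lemma root_of_unity_power: "root_of_unity d k ^ j = root_of_unity d (k * j)"
  unfolding root_of_unity_def Complex.DeMoivre by (simp add: field_simps)

lemma root_of_unity_add_period: "d > 0 \<Longrightarrow> root_of_unity d (k + d * q) = root_of_unity d k"
proof -
  assume d: "d > 0"
  have "2 * pi * real (k + d * q) / real d = 2 * pi * real k / real d + 2 * pi * real q"
    using d by (simp add: field_simps)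
  then show ?thesis unfolding root_of_unity_def
    by (simp only:) (simp add: cis_mult[symmetric] cis_multiple_2pi)
qed

lemma root_of_unity_cong:
  assumes "d > 0" and "[k = l] (mod d)" shows "root_of_unity d k = root_of_unity d l"
proof -
  have "root_of_unity d k = root_of_unity d (k mod d)" for k
    using root_of_unity_add_period[OF assms(1), of "k mod d" "k div d"] by simp
  with assms(2) show ?thesis unfolding cong_def by metis
qed

lemma inj_on_root_of_unity:
  assumes "d > 0" shows "inj_on (root_of_unity d) {1..d}"
proof (rule inj_onI)
  fix k l assume k: "k \<in> {1..d}" and l: "l \<in> {1..d}" and eq: "root_of_unity d k = root_of_unity d l"
  have "inj_on (root_of_unity d) {..<d}"
    using bij_betw_roots_unity[OF assms] by (simp add: bij_betw_def root_of_unity_def[abs_def] mult_ac)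
  moreover have "root_of_unity d (k mod d) = root_of_unity d (l mod d)"
    using eq root_of_unity_cong[OF assms, of "k mod d" k] root_of_unity_cong[OF assms, of "l mod d" l]
    by (simp add: cong_def)
  ultimately have "k mod d = l mod d" using assms by (auto dest: inj_onD)
  with k l show "k = l" by (cases "k = d"; cases "l = d") auto
qed

text \<open>
  Division with remainder by a monic polynomial already works over the integers, and its result is the
  same over the complex numbers.
\<close>
lemma int_poly_dvd_of_complex_dvd:
  fixes f q :: "int poly"
  assumes "lead_coeff f = 1"
    and "map_poly of_int f dvd (map_poly of_int q :: complex poly)"
  shows "f dvd q"
proof -
  let ?h = "map_poly of_int :: int poly \<Rightarrow> complex poly"
  have f: "f \<noteq> 0" using assms(1) by auto
  obtain s r where sr: "pseudo_divmod q f = (s, r)" by fastforce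
  have eq: "q = f * s + r" and r: "r = 0 \<or> degree r < degree f"
    using pseudo_divmod[OF f sr] assms(1) by auto
  have "?h r = ?h q - ?h f * ?h s"
    unfolding eq by (simp only: of_int_poly_hom.hom_add of_int_poly_hom.hom_mult) simp
  then have "?h f dvd ?h r" using assms(2) by simp
  then have "?h r = 0 \<or> degree (?h f) \<le> degree (?h r)" using dvd_imp_degree_le by blast
  with r have "r = 0" by auto
  with eq show ?thesis by simp
qed

lemma lead_coeff_cyclotomic:
  assumes "d > 0" shows "lead_coeff (cyclotomic d) = 1"
proof -
  have "lead_coeff (complex_cyclotomic d) = 1"
    unfolding complex_cyclotomic_def by (simp add: lead_coeff_prod)
  then show ?thesis unfolding cyclotomic_complex[OF assms, symmetric] by (simp add: coeff_map_poly)
qed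

text \<open>
  Irreducibility of the cyclotomic polynomial, in the form in which it is needed. If \<open>m\<close> shares no complex
  root with it, the second alternative is the integral Bezout identity. Otherwise \<open>m\<close> vanishes at one
  primitive \<open>d\<close>-th root of unity; all others are powers of it with exponent coprime to \<open>d\<close>, so \<open>m\<close> vanishes at
  all of them, and these roots are simple.
\<close>
lemma cyclotomic_dvd_or_bezout:
  assumes d: "d > 0"
  shows "cyclotomic d dvd m \<or> (\<exists>u v n. n \<noteq> 0 \<and> u * cyclotomic d + v * m = [:n:])"
proof (cases "\<exists>z. int_eval (cyclotomic d) z = 0 \<and> int_eval m z = 0")
  case False
  moreover have "cyclotomic d \<noteq> 0" using lead_coeff_cyclotomic[OF d] by auto
  ultimately obtain u v n where "n \<noteq> 0" "u * cyclotomic d + v * m = [:n:]"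
    using int_poly_bezout by metis
  then show ?thesis by blast
next
  case True
  let ?K = "{k. 1 \<le> k \<and> k \<le> d \<and> coprime k d}"
  have cyc: "complex_cyclotomic d = (\<Prod>k\<in>?K. [:- root_of_unity d k, 1:])"
    unfolding complex_cyclotomic_def root_of_unity_def ..
  from True obtain z where "poly (complex_cyclotomic d) z = 0" and mz: "int_eval m z = 0"
    unfolding cyclotomic_complex[OF d] by blast
  then obtain k where k: "k \<in> ?K" and zk: "z = root_of_unity d k"
    unfolding cyc poly_prod by (auto simp: prod_zero_iff)
  have "z ^ d = 1"
    using root_of_unity_cong[OF d, of "k * d" 0] unfolding zk root_of_unity_power
    by (simp add: cong_def root_of_unity_def)
  note power = int_eval_root_of_unity_coprime_power[OF d this mz]
  have root: "int_eval m (root_of_unity d l) = 0" if l: "l \<in> ?K" for l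
  proof -
    obtain i where i: "[k * i = 1] (mod d)" using k cong_solve_coprime_nat[of k d] by auto
    \<comment> \<open>The exponent \<open>i * l\<close> carries the root with index \<open>k\<close> to the one with index \<open>l\<close>; adding \<open>d\<close> keeps it positive.\<close>
    have kj: "[k * (i * l + d) = l] (mod d)"
    proof -
      have "[k * i * l + k * d = 1 * l + 0] (mod d)"
        using i by (intro cong_add cong_mult cong_refl) (simp_all add: cong_def)
      then show ?thesis by (simp add: algebra_simps)
    qed
    have "coprime (k * (i * l + d)) d"
      using kj l by (metis (mono_tags, lifting) cong_imp_coprime cong_sym mem_Collect_eq)
    then have "coprime (i * l + d) d" by simp
    moreover have "i * l + d > 0" using d by simp
    ultimately have "int_eval m (z ^ (i * l + d)) = 0" by (rule power)
    then show ?thesis unfolding zk root_of_unity_power root_of_unity_cong[OF d kj] .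
  qed
  have "inj_on (root_of_unity d) ?K"
    using inj_on_root_of_unity[OF d] by (rule inj_on_subset) auto
  then have "complex_cyclotomic d = (\<Prod>z\<in>root_of_unity d ` ?K. [:- z, 1:])"
    unfolding cyc by (simp add: prod.reindex)
  also have "\<dots> dvd map_poly of_int m"
    using root by (intro prod_linear_factors_dvd) auto
  finally have "cyclotomic d dvd m"
    using int_poly_dvd_of_complex_dvd lead_coeff_cyclotomic[OF d] cyclotomic_complex[OF d] by metis
  then show ?thesis ..
qed

lemma cyclotomic_prod: "n > 0 \<Longrightarrow> (\<Prod>d | d dvd n. cyclotomic d) = monom 1 n - 1"
proof -
  assume n: "n > 0"
  let ?h = "map_poly of_int :: int poly \<Rightarrow> complex poly"
  have "?h (\<Prod>d | d dvd n. cyclotomic d) = (\<Prod>d | d dvd n. complex_cyclotomic d)"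
    unfolding of_int_poly_hom.hom_prod
    using n by (intro prod.cong refl cyclotomic_complex) (auto intro: dvd_pos_nat)
  also have "\<dots> = ?h (monom 1 n - 1)"
    unfolding complex_cyclotomic_prod[OF n] by (simp add: hom_distribs)
  finally show ?thesis by (simp only: of_int_poly_hom.eq_iff)
qed

section \<open>Ranks of abelian groups modulo torsion\<close>

lemma hom_finprod:
  assumes "comm_group G" "comm_group H" "h \<in> hom G H" "f \<in> S \<rightarrow> carrier G"
  shows "h (\<Otimes>\<^bsub>G\<^esub>s\<in>S. f s) = (\<Otimes>\<^bsub>H\<^esub>s\<in>S. h (f s))"
proof -
  interpret G: comm_group G by fact
  interpret H: comm_group H by fact
  interpret group_hom G H h by unfold_locales fact
  show ?thesis using assms(4)
    by (induction S rule: infinite_finite_induct) (auto simp: Pi_iff)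
qed

text \<open>
  A relation between the images lifts to a relation up to an element of the kernel, and the \<open>n\<close>-th power removes
  that element; this multiplies the coefficients by \<open>n\<close>, which preserves their vanishing.
\<close>
lemma int_independent_image_iff:
  assumes G: "comm_group G" and H: "comm_group H" and h: "h \<in> hom G H"
    and n: "n > 0" and tors: "\<And>x. x \<in> carrier G \<Longrightarrow> h x = \<one>\<^bsub>H\<^esub> \<Longrightarrow> x [^]\<^bsub>G\<^esub> (n::nat) = \<one>\<^bsub>G\<^esub>"
    and S: "S \<subseteq> carrier G" and inj: "inj_on h S"
  shows "int_independent H (h ` S) \<longleftrightarrow> int_independent G S"
proof -
  interpret G: comm_group G by fact
  interpret H: comm_group H by fact
  interpret group_hom G H h by unfold_locales fact
  have comb: "h (\<Otimes>\<^bsub>G\<^esub>s\<in>S. s [^]\<^bsub>G\<^esub> c (h s)) = (\<Otimes>\<^bsub>H\<^esub>t\<in>h ` S. t [^]\<^bsub>H\<^esub> c t)" for c :: "_ \<Rightarrow> int"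
  proof -
    have "h (\<Otimes>\<^bsub>G\<^esub>s\<in>S. s [^]\<^bsub>G\<^esub> c (h s)) = (\<Otimes>\<^bsub>H\<^esub>s\<in>S. h (s [^]\<^bsub>G\<^esub> c (h s)))"
      using S by (intro hom_finprod[OF G H h]) auto
    also have "\<dots> = (\<Otimes>\<^bsub>H\<^esub>s\<in>S. h s [^]\<^bsub>H\<^esub> c (h s))"
      using S by (intro H.finprod_cong') (auto simp: hom_int_pow)
    also have "\<dots> = (\<Otimes>\<^bsub>H\<^esub>t\<in>h ` S. t [^]\<^bsub>H\<^esub> c t)"
      using S by (intro H.finprod_reindex[symmetric] inj) auto
    finally show ?thesis .
  qed
  show ?thesis
  proof
    assume ind: "int_independent H (h ` S)"
    show "int_independent G S" unfolding int_independent_def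
    proof (intro allI impI ballI)
      fix c :: "'a \<Rightarrow> int" and s
      assume c: "(\<Otimes>\<^bsub>G\<^esub>s\<in>S. s [^]\<^bsub>G\<^esub> c s) = \<one>\<^bsub>G\<^esub>" and s: "s \<in> S"
      define c' where "c' = c \<circ> inv_into S h"
      have c': "c' (h s) = c s" if "s \<in> S" for s using that inj by (simp add: c'_def)
      have "(\<Otimes>\<^bsub>G\<^esub>s\<in>S. s [^]\<^bsub>G\<^esub> c' (h s)) = (\<Otimes>\<^bsub>G\<^esub>s\<in>S. s [^]\<^bsub>G\<^esub> c s)"
        using S c' by (intro G.finprod_cong') auto
      with c comb[of c'] have "(\<Otimes>\<^bsub>H\<^esub>t\<in>h ` S. t [^]\<^bsub>H\<^esub> c' t) = \<one>\<^bsub>H\<^esub>" by simp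
      with ind s have "c' (h s) = 0" unfolding int_independent_def by blast
      with c' s show "c s = 0" by simp
    qed
  next
    assume ind: "int_independent G S"
    show "int_independent H (h ` S)" unfolding int_independent_def
    proof (intro allI impI ballI)
      fix c :: "'c \<Rightarrow> int" and t
      assume c: "(\<Otimes>\<^bsub>H\<^esub>t\<in>h ` S. t [^]\<^bsub>H\<^esub> c t) = \<one>\<^bsub>H\<^esub>" and t: "t \<in> h ` S"
      let ?P = "\<Otimes>\<^bsub>G\<^esub>s\<in>S. s [^]\<^bsub>G\<^esub> c (h s)"
      have "?P \<in> carrier G" using S by (intro G.finprod_closed) auto
      then have "?P [^]\<^bsub>G\<^esub> n = \<one>\<^bsub>G\<^esub>" using tors comb[of c] c by simp
      moreover have "?P [^]\<^bsub>G\<^esub> n = (\<Otimes>\<^bsub>G\<^esub>s\<in>S. (s [^]\<^bsub>G\<^esub> c (h s)) [^]\<^bsub>G\<^esub> n)"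
      proof (rule hom_finprod[OF G G])
        show "(\<lambda>x. x [^]\<^bsub>G\<^esub> n) \<in> hom G G"
          by (auto intro!: homI simp: G.nat_pow_distrib)
      qed (use S in auto)
      moreover have "\<dots> = (\<Otimes>\<^bsub>G\<^esub>s\<in>S. s [^]\<^bsub>G\<^esub> (c (h s) * int n))"
        using S by (intro G.finprod_cong') (auto simp: G.int_pow_pow simp flip: int_pow_int)
      ultimately have "(\<Otimes>\<^bsub>G\<^esub>s\<in>S. s [^]\<^bsub>G\<^esub> (c (h s) * int n)) = \<one>\<^bsub>G\<^esub>" by simp
      with ind have "\<forall>s\<in>S. c (h s) * int n = 0"
        unfolding int_independent_def by (auto dest!: spec[of _ "\<lambda>s. c (h s) * int n"])
      with n t show "c t = 0" by auto
    qed
  qed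
qed

text \<open>
  If \<open>s\<close> and \<open>t\<close> had the same image, \<open>s / t\<close> would be killed by \<open>n\<close>, a nontrivial relation with
  coefficients \<open>n\<close> and \<open>-n\<close>.
\<close>
lemma int_independent_imp_inj_on:
  assumes G: "comm_group G" and H: "comm_group H" and h: "h \<in> hom G H"
    and n: "n > 0" and tors: "\<And>x. x \<in> carrier G \<Longrightarrow> h x = \<one>\<^bsub>H\<^esub> \<Longrightarrow> x [^]\<^bsub>G\<^esub> (n::nat) = \<one>\<^bsub>G\<^esub>"
    and S: "finite S" "S \<subseteq> carrier G" and ind: "int_independent G S"
  shows "inj_on h S"
proof (rule inj_onI, rule ccontr)
  interpret G: comm_group G by fact
  interpret H: comm_group H by fact
  interpret group_hom G H h by unfold_locales fact
  fix s t assume st: "s \<in> S" "t \<in> S" "h s = h t" "s \<noteq> t"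
  then have carr: "s \<in> carrier G" "t \<in> carrier G" using S by auto
  define c where "c = (\<lambda>x. if x = s then int n else if x = t then - int n else 0)"
  have "(\<Otimes>\<^bsub>G\<^esub>x\<in>S. x [^]\<^bsub>G\<^esub> c x) = (\<Otimes>\<^bsub>G\<^esub>x\<in>{s, t}. x [^]\<^bsub>G\<^esub> c x)"
    using S st by (intro G.finprod_mono_neutral_cong_right) (auto simp: c_def)
  also have "\<dots> = s [^]\<^bsub>G\<^esub> int n \<otimes>\<^bsub>G\<^esub> t [^]\<^bsub>G\<^esub> (- int n)"
    using st carr by (simp add: c_def)
  also have "\<dots> = s [^]\<^bsub>G\<^esub> n \<otimes>\<^bsub>G\<^esub> inv\<^bsub>G\<^esub> t [^]\<^bsub>G\<^esub> n"
    using carr by (simp add: G.int_pow_neg int_pow_int G.nat_pow_inv)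
  also have "\<dots> = (s \<otimes>\<^bsub>G\<^esub> inv\<^bsub>G\<^esub> t) [^]\<^bsub>G\<^esub> n"
    using carr by (simp add: G.nat_pow_distrib)
  also have "\<dots> = \<one>\<^bsub>G\<^esub>"
    using carr st(3) by (intro tors) auto
  finally have "c s = 0" using ind st(1) unfolding int_independent_def by blast
  with n show False by (simp add: c_def)
qed

text \<open>
  Independent sets map injectively to independent sets, and choosing preimages lifts independent sets, so that
  the same cardinalities occur on both sides.
\<close>
lemma ab_group_rank_eq_of_torsion_kernel:
  assumes G: "comm_group G" and H: "comm_group H" and h: "h \<in> hom G H"
    and surj: "h ` carrier G = carrier H"
    and n: "n > 0" and tors: "\<And>x. x \<in> carrier G \<Longrightarrow> h x = \<one>\<^bsub>H\<^esub> \<Longrightarrow> x [^]\<^bsub>G\<^esub> (n::nat) = \<one>\<^bsub>G\<^esub>"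
  shows "ab_group_rank G = ab_group_rank H"
proof -
  note iff = int_independent_image_iff[OF G H h n tors]
  note inj = int_independent_imp_inj_on[OF G H h n tors]
  have "{card S | S. finite S \<and> S \<subseteq> carrier G \<and> int_independent G S}
      = {card S | S. finite S \<and> S \<subseteq> carrier H \<and> int_independent H S}" (is "?A = ?B")
  proof
    show "?A \<subseteq> ?B"
    proof clarify
      fix S assume S: "finite S" "S \<subseteq> carrier G" "int_independent G S"
      then have "inj_on h S" by (intro inj)
      with S iff[of S] surj show "\<exists>T. card S = card T \<and> finite T \<and> T \<subseteq> carrier H \<and> int_independent H T"
        by (intro exI[of _ "h ` S"]) (auto simp: card_image)
    qed
    show "?B \<subseteq> ?A"
    proof clarify
      fix T assume T: "finite T" "T \<subseteq> carrier H" "int_independent H T"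
      obtain S where S: "S \<subseteq> carrier G" "inj_on h S" "T = h ` S"
        using T(2) surj by (metis subset_image_inj)
      with T iff[of S] show "\<exists>S. card T = card S \<and> finite S \<and> S \<subseteq> carrier G \<and> int_independent G S"
        by (intro exI[of _ S]) (auto simp: card_image finite_image_iff)
    qed
  qed
  then show ?thesis unfolding ab_group_rank_def by simp
qed

section \<open>Quotients of a module by multiples of a scalar\<close>

lemma quotient_module_simps [simp]:
  "carrier (quotient_module M I) = a_rcosets\<^bsub>M\<^esub> I"
  "zero (quotient_module M I) = I"
  "add (quotient_module M I) = set_add M"
  by (simp_all add: quotient_module_def)

text \<open>
  The additive group of the quotient agrees with the library's factor group in carrier and operations, but not
  in its type, because the underlying record has the scalar multiplication as a further field.
\<close>
lemma comm_group_quotient_module: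
  assumes "abelian_subgroup I M"
  shows "comm_group (add_monoid (quotient_module M I))"
proof -
  interpret abelian_subgroup I M by fact
  interpret F: comm_group "M A_Mod I" by (rule a_factorgroup_is_comm_group)
  note [simp] = A_FactGroup_def'
  show ?thesis
  proof (rule comm_groupI)
    fix X assume X: "X \<in> carrier (add_monoid (quotient_module M I))"
    show "\<exists>Y\<in>carrier (add_monoid (quotient_module M I)).
        Y \<otimes>\<^bsub>add_monoid (quotient_module M I)\<^esub> X = \<one>\<^bsub>add_monoid (quotient_module M I)\<^esub>"
      using F.l_inv[of X] F.inv_closed[of X] X by auto
  qed (use F.m_closed F.one_closed F.m_assoc F.m_comm F.l_one in simp_all)
qed

lemma smult_image_abelian_subgroup:
  assumes "Module.module R M" and a: "a \<in> carrier R"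
  shows "abelian_subgroup ((\<lambda>m. a \<odot>\<^bsub>M\<^esub> m) ` carrier M) M"
proof -
  interpret Module.module R M by fact
  have "subgroup ((\<lambda>m. a \<odot>\<^bsub>M\<^esub> m) ` carrier M) (add_monoid M)"
  proof (rule M.add.subgroupI)
    fix x y assume "x \<in> (\<lambda>m. a \<odot>\<^bsub>M\<^esub> m) ` carrier M" "y \<in> (\<lambda>m. a \<odot>\<^bsub>M\<^esub> m) ` carrier M"
    then obtain m m' where m: "m \<in> carrier M" "m' \<in> carrier M" "x = a \<odot>\<^bsub>M\<^esub> m" "y = a \<odot>\<^bsub>M\<^esub> m'" by auto
    then show "x \<oplus>\<^bsub>M\<^esub> y \<in> (\<lambda>m. a \<odot>\<^bsub>M\<^esub> m) ` carrier M"
      using a by (intro image_eqI[of _ _ "m \<oplus>\<^bsub>M\<^esub> m'"]) (auto simp: smult_r_distr)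
    show "\<ominus>\<^bsub>M\<^esub> x \<in> (\<lambda>m. a \<odot>\<^bsub>M\<^esub> m) ` carrier M"
      using a m by (intro image_eqI[of _ _ "\<ominus>\<^bsub>M\<^esub> m"]) (auto simp: smult_r_minus)
  qed (use a in auto)
  then show ?thesis
    by (intro abelian_subgroupI3 additive_subgroup.intro M.abelian_group_axioms)
qed

text \<open>
  The canonical surjection from the quotient by \<open>I\<close> to the quotient by \<open>J\<close> is realized on cosets as addition of \<open>J\<close>.
  Its kernel is the image of \<open>J\<close>, which \<open>n\<close> kills.
\<close>
lemma rank_quotient_eq_of_torsion:
  assumes M: "abelian_group M" and I: "abelian_subgroup I M" and J: "abelian_subgroup J M"
    and IJ: "I \<subseteq> J" and n: "n > (0 :: nat)" and tors: "\<And>a. a \<in> J \<Longrightarrow> add_pow M n a \<in> I"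
  shows "ab_group_rank (add_monoid (quotient_module M I)) = ab_group_rank (add_monoid (quotient_module M J))"
proof (rule ab_group_rank_eq_of_torsion_kernel[OF _ _ _ _ n])
  interpret M: abelian_group M by fact
  interpret I: abelian_subgroup I M by fact
  interpret J: abelian_subgroup J M by fact
  let ?Q = "\<lambda>K. add_monoid (quotient_module M K)"
  show "comm_group (?Q I)" and "comm_group (?Q J)"
    by (rule comm_group_quotient_module I J)+
  have carrier: "carrier (?Q K) = (\<lambda>a. K +>\<^bsub>M\<^esub> a) ` carrier M" for K
    by (auto simp: A_RCOSETS_def')
  let ?h = "\<lambda>C. J <+>\<^bsub>M\<^esub> C"
  have h: "?h (I +>\<^bsub>M\<^esub> a) = J +>\<^bsub>M\<^esub> a" if a: "a \<in> carrier M" for a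
  proof -
    have "J <+>\<^bsub>M\<^esub> I = J"
    proof
      show "J <+>\<^bsub>M\<^esub> I \<subseteq> J" using IJ J.a_closed by (auto simp: set_add_def')
      show "J \<subseteq> J <+>\<^bsub>M\<^esub> I"
      proof
        fix j assume "j \<in> J"
        then have "j = j \<oplus>\<^bsub>M\<^esub> \<zero>\<^bsub>M\<^esub>" by simp
        with \<open>j \<in> J\<close> I.zero_closed show "j \<in> J <+>\<^bsub>M\<^esub> I" unfolding set_add_def' by blast
      qed
    qed
    moreover have "J <+>\<^bsub>M\<^esub> (I +>\<^bsub>M\<^esub> a) = (J <+>\<^bsub>M\<^esub> I) +>\<^bsub>M\<^esub> a"
      using a by (intro M.a_setmult_rcos_assoc I.a_subset J.a_subset)
    ultimately show ?thesis by simp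
  qed
  show surj: "?h ` carrier (?Q I) = carrier (?Q J)"
    unfolding carrier image_image using h by (intro image_cong) auto
  show "?h \<in> hom (?Q I) (?Q J)"
  proof (rule homI)
    fix X assume "X \<in> carrier (?Q I)"
    then show "?h X \<in> carrier (?Q J)" using surj by auto
    fix Y assume "Y \<in> carrier (?Q I)"
    with \<open>X \<in> carrier (?Q I)\<close> show "?h (X \<otimes>\<^bsub>?Q I\<^esub> Y) = ?h X \<otimes>\<^bsub>?Q J\<^esub> ?h Y"
      unfolding carrier by (auto simp: I.a_rcos_sum J.a_rcos_sum h)
  qed
  fix X assume X: "X \<in> carrier (?Q I)" and hX: "?h X = \<one>\<^bsub>?Q J\<^esub>"
  from X obtain a where a: "a \<in> carrier M" "X = I +>\<^bsub>M\<^esub> a" unfolding carrier by auto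
  with hX h have "J +>\<^bsub>M\<^esub> a = J" by simp
  then have "a \<in> J" using a J.a_rcos_self by metis
  then have na: "add_pow M n a \<in> I" by (rule tors)
  have pow: "(I +>\<^bsub>M\<^esub> a) [^]\<^bsub>?Q I\<^esub> k = I +>\<^bsub>M\<^esub> (add_pow M k a)" for k :: nat
  proof (induction k)
    case 0
    show ?case using I.a_rcos_const I.zero_closed by simp
  next
    case (Suc k)
    then show ?case using a I.a_rcos_sum by simp
  qed
  show "X [^]\<^bsub>?Q I\<^esub> n = \<one>\<^bsub>?Q I\<^esub>"
    unfolding a(2) pow using na I.a_rcos_const by simp
qed

abbreviation cmodule :: "('r :: comm_ring_1, 'm, 'c) module_scheme \<Rightarrow> bool" where
  "cmodule M \<equiv> Module.module (class_ring :: 'r ring) M"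

lemma of_nat_smult:
  fixes M :: "('r :: comm_ring_1, 'm, 'c) module_scheme"
  assumes "cmodule M" and m: "m \<in> carrier M"
  shows "of_nat n \<odot>\<^bsub>M\<^esub> m = add_pow M n m"
proof -
  interpret Module.module class_ring M by fact
  show ?thesis
  proof (induction n)
    case 0
    show ?case using smult_l_null[OF m] by simp
  next
    case (Suc n)
    have "of_nat (Suc n) \<odot>\<^bsub>M\<^esub> m = (of_nat n \<odot>\<^bsub>M\<^esub> m) \<oplus>\<^bsub>M\<^esub> (1 \<odot>\<^bsub>M\<^esub> m)"
      using smult_l_distr[of "of_nat n" 1 m] m by (simp add: add.commute)
    then show ?case using Suc smult_one[OF m] m by simp
  qed
qed

text \<open>
  The cokernel of multiplication by \<open>h\<close> on \<open>M\<close> is killed by some positive integer.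
\<close>
definition divisible_up_to_torsion :: "('r :: comm_ring_1, 'm, 'c) module_scheme \<Rightarrow> 'r \<Rightarrow> bool" where
  "divisible_up_to_torsion M h \<longleftrightarrow>
     (\<exists>n>0. \<forall>m\<in>carrier M. \<exists>m'\<in>carrier M. of_nat n \<odot>\<^bsub>M\<^esub> m = h \<odot>\<^bsub>M\<^esub> m')"

lemma divisible_up_to_torsion_mult:
  assumes "cmodule M" and "divisible_up_to_torsion M h" and "divisible_up_to_torsion M k"
  shows "divisible_up_to_torsion M (h * k)"
proof -
  interpret Module.module class_ring M by fact
  have assoc: "(a * b) \<odot>\<^bsub>M\<^esub> m = a \<odot>\<^bsub>M\<^esub> (b \<odot>\<^bsub>M\<^esub> m)" if "m \<in> carrier M" for a b m
    using smult_assoc1[of a b m] that by simp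
  obtain n1 where n1: "n1 > 0"
    "\<And>m. m \<in> carrier M \<Longrightarrow> \<exists>m'\<in>carrier M. of_nat n1 \<odot>\<^bsub>M\<^esub> m = h \<odot>\<^bsub>M\<^esub> m'"
    using assms(2) unfolding divisible_up_to_torsion_def by blast
  obtain n2 where n2: "n2 > 0"
    "\<And>m. m \<in> carrier M \<Longrightarrow> \<exists>m'\<in>carrier M. of_nat n2 \<odot>\<^bsub>M\<^esub> m = k \<odot>\<^bsub>M\<^esub> m'"
    using assms(3) unfolding divisible_up_to_torsion_def by blast
  show ?thesis unfolding divisible_up_to_torsion_def
  proof (intro exI conjI ballI)
    show "n1 * n2 > 0" using n1 n2 by simp
    fix m assume m: "m \<in> carrier M"
    obtain m1 where m1: "m1 \<in> carrier M" "of_nat n1 \<odot>\<^bsub>M\<^esub> m = h \<odot>\<^bsub>M\<^esub> m1" using n1(2)[OF m] by blast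
    obtain m2 where m2: "m2 \<in> carrier M" "of_nat n2 \<odot>\<^bsub>M\<^esub> m1 = k \<odot>\<^bsub>M\<^esub> m2" using n2(2)[OF m1(1)] by blast
    have "of_nat (n1 * n2) \<odot>\<^bsub>M\<^esub> m = of_nat n2 \<odot>\<^bsub>M\<^esub> (h \<odot>\<^bsub>M\<^esub> m1)"
      using assoc[OF m, of "of_nat n2" "of_nat n1"] m1 by (simp add: mult.commute)
    also have "\<dots> = h \<odot>\<^bsub>M\<^esub> (of_nat n2 \<odot>\<^bsub>M\<^esub> m1)"
      using m1(1) by (simp add: mult.commute flip: assoc)
    also have "\<dots> = (h * k) \<odot>\<^bsub>M\<^esub> m2" unfolding m2 assoc[OF m2(1)] ..
    finally show "\<exists>m'\<in>carrier M. of_nat (n1 * n2) \<odot>\<^bsub>M\<^esub> m = (h * k) \<odot>\<^bsub>M\<^esub> m'" using m2(1) by blast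
  qed
qed

lemma divisible_up_to_torsion_prod:
  assumes "cmodule M" and "\<And>i. i \<in> S \<Longrightarrow> divisible_up_to_torsion M (h i)"
  shows "divisible_up_to_torsion M (\<Prod>i\<in>S. h i)"
proof -
  have "divisible_up_to_torsion M 1"
    unfolding divisible_up_to_torsion_def by (intro exI[of _ 1]) auto
  with assms(2) show ?thesis
    by (induction S rule: infinite_finite_induct) (auto intro: divisible_up_to_torsion_mult[OF assms(1)])
qed

text \<open>
  If \<open>n M \<subseteq> h M\<close>, then \<open>n (g M) = g (n M) \<subseteq> g h M\<close>, so the previous criterion applies to \<open>g h M \<subseteq> g M\<close>.
\<close>
lemma rank_quotient_smult_eq:
  assumes M: "cmodule M" and h: "divisible_up_to_torsion M h"
  shows "ab_group_rank (add_monoid (quotient_module M ((\<lambda>m. (g * h) \<odot>\<^bsub>M\<^esub> m) ` carrier M)))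
       = ab_group_rank (add_monoid (quotient_module M ((\<lambda>m. g \<odot>\<^bsub>M\<^esub> m) ` carrier M)))"
proof -
  interpret Module.module class_ring M by fact
  have assoc: "(a * b) \<odot>\<^bsub>M\<^esub> m = a \<odot>\<^bsub>M\<^esub> (b \<odot>\<^bsub>M\<^esub> m)" if "m \<in> carrier M" for a b m
    using smult_assoc1[of a b m] that by simp
  have closed: "a \<odot>\<^bsub>M\<^esub> m \<in> carrier M" if "m \<in> carrier M" for a m
    using smult_closed[of a m] that by simp
  obtain n where n: "n > 0" "\<And>m. m \<in> carrier M \<Longrightarrow> \<exists>m'\<in>carrier M. of_nat n \<odot>\<^bsub>M\<^esub> m = h \<odot>\<^bsub>M\<^esub> m'"
    using h unfolding divisible_up_to_torsion_def by blast
  show ?thesis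
  proof (rule rank_quotient_eq_of_torsion[OF _ _ _ _ n(1)])
    show "abelian_group M" ..
    show "abelian_subgroup ((\<lambda>m. (g * h) \<odot>\<^bsub>M\<^esub> m) ` carrier M) M"
      and "abelian_subgroup ((\<lambda>m. g \<odot>\<^bsub>M\<^esub> m) ` carrier M) M"
      by (rule smult_image_abelian_subgroup[OF M]; simp)+
    show "(\<lambda>m. (g * h) \<odot>\<^bsub>M\<^esub> m) ` carrier M \<subseteq> (\<lambda>m. g \<odot>\<^bsub>M\<^esub> m) ` carrier M"
      by (auto simp: assoc closed)
    fix a assume "a \<in> (\<lambda>m. g \<odot>\<^bsub>M\<^esub> m) ` carrier M"
    then obtain m where m: "m \<in> carrier M" "a = g \<odot>\<^bsub>M\<^esub> m" by auto
    obtain m' where m': "m' \<in> carrier M" "of_nat n \<odot>\<^bsub>M\<^esub> m = h \<odot>\<^bsub>M\<^esub> m'" using n(2)[OF m(1)] by blast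
    have "add_pow M n a = of_nat n \<odot>\<^bsub>M\<^esub> (g \<odot>\<^bsub>M\<^esub> m)"
      unfolding m(2) using of_nat_smult[OF M closed[OF m(1)]] by simp
    also have "\<dots> = g \<odot>\<^bsub>M\<^esub> (of_nat n \<odot>\<^bsub>M\<^esub> m)"
      using m(1) by (simp add: mult.commute flip: assoc)
    also have "\<dots> = (g * h) \<odot>\<^bsub>M\<^esub> m'" unfolding m' assoc[OF m'(1)] ..
    finally show "add_pow M n a \<in> (\<lambda>m. (g * h) \<odot>\<^bsub>M\<^esub> m) ` carrier M" using m'(1) by blast
  qed
qed

section \<open>The abelianized kernel as an abelian group with scalars\<close>

lemma kernel_normal:
  assumes "augmented_group G \<chi>"
  shows "kernel G integer_group \<chi> \<lhd> G"
proof -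
  interpret augmented_group G \<chi> by fact
  have "\<chi> \<in> hom G integer_group" using epi by (simp add: epi_def)
  then interpret group_hom G integer_group \<chi>
    by (intro group_hom.intro group_hom_axioms.intro is_group group_integer_group)
  show ?thesis by (rule normal_kernel)
qed

lemma comm_group_kernel_abelianization:
  assumes "augmented_group G \<chi>"
  shows "comm_group (kernel_abelianization G \<chi>)"
proof -
  interpret augmented_group G \<chi> by fact
  define K where "K = kernel G integer_group \<chi>"
  have K: "subgroup K G" using kernel_normal[OF assms] unfolding K_def by (rule normal_imp_subgroup)
  interpret K: group "G\<lparr>carrier := K\<rparr>" using K by (rule subgroup_imp_group)
  have "derived (G\<lparr>carrier := K\<rparr>) K = derived G K"
    by (rule derived_consistent[OF order_refl K])
  then show ?thesis
    using K.derived_quot_is_comm_group by (simp add: kernel_abelianization_def K_def Let_def)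
qed

text \<open>
  Conjugation by \<open>y\<close> preserves the kernel \<open>K\<close> and its derived subgroup \<open>D\<close>, both normal in \<open>G\<close>; hence it sends the
  coset of \<open>k\<close> to the coset of the conjugate of \<open>k\<close>.
\<close>
lemma conj_coset_closed:
  assumes "augmented_group G \<chi>" and y: "y \<in> carrier G"
    and C: "C \<in> carrier (kernel_abelianization G \<chi>)"
  shows "conj_coset G y C \<in> carrier (kernel_abelianization G \<chi>)"
proof -
  interpret augmented_group G \<chi> by fact
  define K where "K = kernel G integer_group \<chi>"
  define D where "D = derived G K"
  have K: "K \<lhd> G" using kernel_normal[OF assms(1)] unfolding K_def .
  have D: "D \<lhd> G" unfolding D_def by (rule derived_is_normal[OF K])
  have K_sub: "K \<subseteq> carrier G" and D_sub: "D \<subseteq> carrier G"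
    using K D by (auto dest!: normal_imp_subgroup subgroup.subset)
  have carrier: "carrier (kernel_abelianization G \<chi>) = (\<lambda>k. D #>\<^bsub>G\<^esub> k) ` K"
    by (auto simp: kernel_abelianization_def Let_def FactGroup_def RCOSETS_def r_coset_def K_def D_def)
  obtain k where k: "k \<in> K" "C = D #>\<^bsub>G\<^esub> k" using C unfolding carrier by auto
  have k': "k \<in> carrier G" using k K_sub by auto
  let ?k = "y \<otimes>\<^bsub>G\<^esub> k \<otimes>\<^bsub>G\<^esub> inv\<^bsub>G\<^esub> y"
  have split: "y \<otimes>\<^bsub>G\<^esub> (d \<otimes>\<^bsub>G\<^esub> k) \<otimes>\<^bsub>G\<^esub> inv\<^bsub>G\<^esub> y = (y \<otimes>\<^bsub>G\<^esub> d \<otimes>\<^bsub>G\<^esub> inv\<^bsub>G\<^esub> y) \<otimes>\<^bsub>G\<^esub> ?k"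
    if "d \<in> carrier G" for d
  proof -
    have "inv\<^bsub>G\<^esub> y \<otimes>\<^bsub>G\<^esub> (y \<otimes>\<^bsub>G\<^esub> (k \<otimes>\<^bsub>G\<^esub> inv\<^bsub>G\<^esub> y)) = k \<otimes>\<^bsub>G\<^esub> inv\<^bsub>G\<^esub> y"
      using y k' by (simp flip: m_assoc)
    then show ?thesis using that y k' by (simp add: m_assoc)
  qed
  have "conj_coset G y C = (\<lambda>d. (y \<otimes>\<^bsub>G\<^esub> d \<otimes>\<^bsub>G\<^esub> inv\<^bsub>G\<^esub> y) \<otimes>\<^bsub>G\<^esub> ?k) ` D"
  proof -
    have "conj_coset G y C = (\<lambda>d. y \<otimes>\<^bsub>G\<^esub> (d \<otimes>\<^bsub>G\<^esub> k) \<otimes>\<^bsub>G\<^esub> inv\<^bsub>G\<^esub> y) ` D"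
      unfolding conj_coset_def k(2) r_coset_def by auto
    then show ?thesis using split D_sub by (simp add: subset_iff cong: image_cong)
  qed
  also have "\<dots> = (\<lambda>d. d \<otimes>\<^bsub>G\<^esub> ?k) ` (\<lambda>d. y \<otimes>\<^bsub>G\<^esub> d \<otimes>\<^bsub>G\<^esub> inv\<^bsub>G\<^esub> y) ` D"
    by (simp add: image_image)
  also have "(\<lambda>d. y \<otimes>\<^bsub>G\<^esub> d \<otimes>\<^bsub>G\<^esub> inv\<^bsub>G\<^esub> y) ` D = D"
  proof
    show "(\<lambda>d. y \<otimes>\<^bsub>G\<^esub> d \<otimes>\<^bsub>G\<^esub> inv\<^bsub>G\<^esub> y) ` D \<subseteq> D"
      using normal.inv_op_closed2[OF D y] by auto
    show "D \<subseteq> (\<lambda>d. y \<otimes>\<^bsub>G\<^esub> d \<otimes>\<^bsub>G\<^esub> inv\<^bsub>G\<^esub> y) ` D"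
    proof
      fix d assume d: "d \<in> D"
      then have "d \<in> carrier G" using D_sub by auto
      then have "d = y \<otimes>\<^bsub>G\<^esub> (inv\<^bsub>G\<^esub> y \<otimes>\<^bsub>G\<^esub> d \<otimes>\<^bsub>G\<^esub> y) \<otimes>\<^bsub>G\<^esub> inv\<^bsub>G\<^esub> y"
        using y by (simp add: m_assoc) (simp flip: m_assoc)
      moreover have "inv\<^bsub>G\<^esub> y \<otimes>\<^bsub>G\<^esub> d \<otimes>\<^bsub>G\<^esub> y \<in> D"
        using normal.inv_op_closed1[OF D y d] .
      ultimately show "d \<in> (\<lambda>d. y \<otimes>\<^bsub>G\<^esub> d \<otimes>\<^bsub>G\<^esub> inv\<^bsub>G\<^esub> y) ` D" by (rule image_eqI)
    qed
  qed
  also have "(\<lambda>d. d \<otimes>\<^bsub>G\<^esub> ?k) ` D = D #>\<^bsub>G\<^esub> ?k" by (auto simp: r_coset_def)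
  finally show ?thesis
    unfolding carrier using normal.inv_op_closed2[OF K y k(1)] by blast
qed

lemma abelian_group_augmentation_module:
  assumes "augmented_group G \<chi>"
  shows "abelian_group (augmentation_module G \<chi> x)"
proof -
  interpret comm_group "kernel_abelianization G \<chi>"
    by (rule comm_group_kernel_abelianization[OF assms])
  show ?thesis
    by (rule abelian_groupI)
      (simp_all add: augmentation_module_def Let_def m_assoc l_inv_ex, rule m_comm)
qed

text \<open>
  The module laws follow later from a presentation, since a module homomorphism transports them; closure
  under the action cannot be transported and needs this direct argument.
\<close>
lemma augmentation_module_smult_closed:
  assumes "augmented_group G \<chi>" and x: "x \<in> carrier G"
    and C: "C \<in> carrier (augmentation_module G \<chi> x)"
  shows "p \<odot>\<^bsub>augmentation_module G \<chi> x\<^esub> C \<in> carrier (augmentation_module G \<chi> x)"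
proof -
  interpret G: augmented_group G \<chi> by fact
  interpret comm_group "kernel_abelianization G \<chi>"
    by (rule comm_group_kernel_abelianization[OF assms(1)])
  have "conj_coset G (x [^]\<^bsub>G\<^esub> i) C \<in> carrier (kernel_abelianization G \<chi>)" for i :: int
    using C x by (intro conj_coset_closed[OF assms(1)]) (auto simp: augmentation_module_def Let_def)
  then show ?thesis
    by (auto simp: augmentation_module_def Let_def intro!: finprod_closed int_pow_closed)
qed

section \<open>Presentation matrices and their maximal minors\<close>

lemma mult_mat_vec_smult:
  fixes A :: "'r :: comm_ring_1 mat"
  assumes A: "A \<in> carrier_mat N K" and w: "w \<in> carrier_vec K"
  shows "A *\<^sub>v (a \<cdot>\<^sub>v w) = a \<cdot>\<^sub>v (A *\<^sub>v w)"
  by (rule eq_vecI) (use A w in \<open>auto simp: scalar_prod_def sum_distrib_left algebra_simps intro!: sum.cong\<close>)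

lemma abelian_group_module_vec: "abelian_group (module_vec TYPE('r :: comm_ring_1) N)"
proof (rule abelian_groupI)
  fix v :: "'r vec" assume "v \<in> carrier (module_vec TYPE('r) N)"
  then show "\<exists>w\<in>carrier (module_vec TYPE('r) N). w \<oplus>\<^bsub>module_vec TYPE('r) N\<^esub> v = \<zero>\<^bsub>module_vec TYPE('r) N\<^esub>"
    by (intro bexI[of _ "- v"]) (auto simp: module_vec_simps)
qed (auto simp: module_vec_simps assoc_add_vec[of _ N] comm_add_vec[of _ N])

lemma mult_mat_vec_image_abelian_subgroup:
  fixes A :: "'r :: comm_ring_1 mat"
  assumes A: "A \<in> carrier_mat N K"
  shows "abelian_subgroup ((\<lambda>v. A *\<^sub>v v) ` carrier_vec K) (module_vec TYPE('r) N)"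
proof -
  let ?V = "module_vec TYPE('r) N"
  interpret V: abelian_group ?V by (rule abelian_group_module_vec)
  have "subgroup ((\<lambda>v. A *\<^sub>v v) ` carrier_vec K) (add_monoid ?V)"
  proof (rule V.add.subgroupI)
    show "(\<lambda>v. A *\<^sub>v v) ` carrier_vec K \<subseteq> carrier ?V"
      using A by (auto simp: module_vec_simps)
    show "(\<lambda>v. A *\<^sub>v v) ` carrier_vec K \<noteq> {}" by (auto intro: zero_carrier_vec)
    fix x y assume "x \<in> (\<lambda>v. A *\<^sub>v v) ` carrier_vec K" "y \<in> (\<lambda>v. A *\<^sub>v v) ` carrier_vec K"
    then obtain v w where v: "v \<in> carrier_vec K" "w \<in> carrier_vec K" "x = A *\<^sub>v v" "y = A *\<^sub>v w" by auto
    then show "x \<oplus>\<^bsub>?V\<^esub> y \<in> (\<lambda>v. A *\<^sub>v v) ` carrier_vec K"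
      using A by (intro image_eqI[of _ _ "v + w"]) (auto simp: module_vec_simps mult_add_distrib_mat_vec[of _ N K])
    have "\<ominus>\<^bsub>?V\<^esub> x = - x"
    proof (rule V.minus_equality)
      show "- x \<oplus>\<^bsub>?V\<^esub> x = \<zero>\<^bsub>?V\<^esub>" and "x \<in> carrier ?V" and "- x \<in> carrier ?V"
        using v A by (auto simp: module_vec_simps)
    qed
    also have "- x = A *\<^sub>v (- v)"
      unfolding v(3) using A v(1) by (auto intro!: eq_vecI)
    finally show "\<ominus>\<^bsub>?V\<^esub> x \<in> (\<lambda>v. A *\<^sub>v v) ` carrier_vec K" using v(1) by auto
  qed
  then show ?thesis
    by (intro abelian_subgroupI3 additive_subgroup.intro V.abelian_group_axioms)
qed

text \<open>
  Following the projection onto the cokernel by the inverse of the isomorphism gives a linear surjection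
  from the free module that kills the range of \<open>A\<close>. Besides carrying these relations, it is the source of
  the module laws of \<open>M\<close>.
\<close>
lemma cokernel_presentation:
  fixes M :: "(laurent, 'm, 'c) module_scheme"
  assumes "abelian_group M" and closed: "\<And>a m. m \<in> carrier M \<Longrightarrow> a \<odot>\<^bsub>M\<^esub> m \<in> carrier M"
    and A: "A \<in> carrier_mat N K"
    and iso: "module_isomorphic class_ring M (cokernel_module N K A)"
  obtains \<phi> where "\<phi> ` carrier_vec N = carrier M"
    and "\<And>u v. u \<in> carrier_vec N \<Longrightarrow> v \<in> carrier_vec N \<Longrightarrow> \<phi> (u + v) = \<phi> u \<oplus>\<^bsub>M\<^esub> \<phi> v"
    and "\<And>a v. v \<in> carrier_vec N \<Longrightarrow> \<phi> (a \<cdot>\<^sub>v v) = a \<odot>\<^bsub>M\<^esub> \<phi> v"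
    and "\<And>w. w \<in> carrier_vec K \<Longrightarrow> \<phi> (A *\<^sub>v w) = \<zero>\<^bsub>M\<^esub>"
proof -
  interpret M: abelian_group M by fact
  let ?V = "module_vec TYPE(laurent) N"
  define I where "I = (\<lambda>v. A *\<^sub>v v) ` carrier_vec K"
  interpret V: abelian_group ?V by (rule abelian_group_module_vec)
  interpret I: abelian_subgroup I ?V
    unfolding I_def by (rule mult_mat_vec_image_abelian_subgroup[OF A])
  let ?Q = "quotient_module ?V I"
  obtain f where f: "f \<in> LinearCombinations.module_hom class_ring M ?Q"
    and bij: "bij_betw f (carrier M) (carrier ?Q)"
    using iso unfolding module_isomorphic_def cokernel_module_def I_def by blast
  have carrier_Q: "carrier ?Q = (\<lambda>v. I +>\<^bsub>?V\<^esub> v) ` carrier_vec N"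
    by (auto simp: A_RCOSETS_def' module_vec_simps)
  have f_add: "f (m \<oplus>\<^bsub>M\<^esub> m') = f m <+>\<^bsub>?V\<^esub> f m'" if "m \<in> carrier M" "m' \<in> carrier M" for m m'
    using LinearCombinations.module_hom_add[OF f that] by simp
  have f_smult: "f (a \<odot>\<^bsub>M\<^esub> m) = (\<Union>c\<in>f m. I +>\<^bsub>?V\<^esub> (a \<cdot>\<^sub>v c))" if "m \<in> carrier M" for a m
    using LinearCombinations.module_hom_smult[OF f, of a m] that
    by (simp add: quotient_module_def module_vec_simps)
  have inj: "m = m'" if "m \<in> carrier M" "m' \<in> carrier M" "f m = f m'" for m m'
    using bij that by (auto simp: bij_betw_def dest: inj_onD)
  define \<phi> where "\<phi> v = inv_into (carrier M) f (I +>\<^bsub>?V\<^esub> v)" for v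
  have \<phi>: "\<phi> v \<in> carrier M" "f (\<phi> v) = I +>\<^bsub>?V\<^esub> v" if "v \<in> carrier_vec N" for v
    using that bij carrier_Q unfolding \<phi>_def bij_betw_def
    by (auto intro!: inv_into_into f_inv_into_f)
  have add: "\<phi> (u + v) = \<phi> u \<oplus>\<^bsub>M\<^esub> \<phi> v" if uv: "u \<in> carrier_vec N" "v \<in> carrier_vec N" for u v
  proof (rule inj)
    show "f (\<phi> (u + v)) = f (\<phi> u \<oplus>\<^bsub>M\<^esub> \<phi> v)"
      using uv \<phi> f_add I.a_rcos_sum[of u v] by (simp add: module_vec_simps)
  qed (use uv \<phi> in auto)
  have smult: "\<phi> (a \<cdot>\<^sub>v v) = a \<odot>\<^bsub>M\<^esub> \<phi> v" if v: "v \<in> carrier_vec N" for a v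
  proof (rule inj)
    have eq: "I +>\<^bsub>?V\<^esub> (a \<cdot>\<^sub>v c) = I +>\<^bsub>?V\<^esub> (a \<cdot>\<^sub>v v)" if c: "c \<in> I +>\<^bsub>?V\<^esub> v" for c
    proof -
      obtain w where w: "w \<in> carrier_vec K" "c = A *\<^sub>v w + v"
        using c by (auto simp: a_r_coset_def' I_def module_vec_simps)
      have Aw: "A *\<^sub>v w \<in> carrier_vec N" using A w(1) by (rule mult_mat_vec_carrier)
      have "a \<cdot>\<^sub>v c = A *\<^sub>v (a \<cdot>\<^sub>v w) + a \<cdot>\<^sub>v v"
        unfolding w(2) using smult_add_distrib_vec[OF Aw v] mult_mat_vec_smult[OF A w(1)] by simp
      moreover have "A *\<^sub>v (a \<cdot>\<^sub>v w) \<in> I" using w(1) unfolding I_def by auto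
      ultimately have "a \<cdot>\<^sub>v c \<in> I +>\<^bsub>?V\<^esub> (a \<cdot>\<^sub>v v)"
        by (auto simp: a_r_coset_def' module_vec_simps)
      then show ?thesis
        using v by (intro V.a_repr_independence[symmetric] I.a_subgroup) (auto simp: module_vec_simps)
    qed
    have "v \<in> I +>\<^bsub>?V\<^esub> v" using v I.a_rcos_self by (simp add: module_vec_simps)
    then have "f (a \<odot>\<^bsub>M\<^esub> \<phi> v) = I +>\<^bsub>?V\<^esub> (a \<cdot>\<^sub>v v)"
      unfolding f_smult[OF \<phi>(1)[OF v]] \<phi>(2)[OF v] using eq by blast
    then show "f (\<phi> (a \<cdot>\<^sub>v v)) = f (a \<odot>\<^bsub>M\<^esub> \<phi> v)" using v \<phi> by simp
  qed (use v \<phi> closed in auto)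
  \<comment> \<open>An idempotent of a group is neutral.\<close>
  have "\<phi> (0\<^sub>v N) = \<zero>\<^bsub>M\<^esub>"
  proof -
    have "\<phi> (0\<^sub>v N) \<oplus>\<^bsub>M\<^esub> \<phi> (0\<^sub>v N) = \<phi> (0\<^sub>v N)"
      using add[of "0\<^sub>v N" "0\<^sub>v N"] by simp
    with \<phi>(1)[of "0\<^sub>v N"] show ?thesis by (simp add: M.add.r_cancel_one)
  qed
  moreover have "I +>\<^bsub>?V\<^esub> (A *\<^sub>v w) = I +>\<^bsub>?V\<^esub> 0\<^sub>v N" if "w \<in> carrier_vec K" for w
    using that I.a_rcos_const I.zero_closed by (auto simp: I_def module_vec_simps)
  ultimately have zero: "\<phi> (A *\<^sub>v w) = \<zero>\<^bsub>M\<^esub>" if "w \<in> carrier_vec K" for w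
    using that unfolding \<phi>_def by simp
  have "\<phi> ` carrier_vec N = carrier M"
  proof
    show "carrier M \<subseteq> \<phi> ` carrier_vec N"
    proof
      fix m assume m: "m \<in> carrier M"
      then have "f m \<in> carrier ?Q" using bij by (auto simp: bij_betw_def)
      then obtain v where v: "v \<in> carrier_vec N" "f m = I +>\<^bsub>?V\<^esub> v" unfolding carrier_Q by auto
      then have "m = \<phi> v" using m \<phi>[OF v(1)] inj by simp
      with v show "m \<in> \<phi> ` carrier_vec N" by blast
    qed
  qed (use \<phi> in auto)
  from this add smult zero show thesis by (rule that)
qed

text \<open>
  Every module law is the image of the corresponding law for vectors.
\<close>
lemma cmodule_of_surjection:
  fixes M :: "('r :: comm_ring_1, 'm, 'c) module_scheme"
  assumes "abelian_group M"
    and surj: "\<phi> ` carrier_vec N = carrier M"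
    and add: "\<And>u v. u \<in> carrier_vec N \<Longrightarrow> v \<in> carrier_vec N \<Longrightarrow> \<phi> (u + v) = \<phi> u \<oplus>\<^bsub>M\<^esub> \<phi> v"
    and smult: "\<And>a v. v \<in> carrier_vec N \<Longrightarrow> \<phi> (a \<cdot>\<^sub>v v) = a \<odot>\<^bsub>M\<^esub> \<phi> v"
  shows "cmodule M"
proof (rule Module.moduleI)
  show "cring (class_ring :: 'r ring)" by (rule class_cring.is_cring)
  have lift: "\<exists>v\<in>carrier_vec N. m = \<phi> v" if "m \<in> carrier M" for m using that surj by blast
  fix a b :: 'r and m m' assume m: "m \<in> carrier M" and m': "m' \<in> carrier M"
  obtain v where v: "v \<in> carrier_vec N" "m = \<phi> v" using lift[OF m] by blast
  obtain v' where v': "v' \<in> carrier_vec N" "m' = \<phi> v'" using lift[OF m'] by blast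
  show "a \<odot>\<^bsub>M\<^esub> m \<in> carrier M" using v surj by (auto simp flip: smult)
  show "(a \<oplus>\<^bsub>class_ring\<^esub> b) \<odot>\<^bsub>M\<^esub> m = a \<odot>\<^bsub>M\<^esub> m \<oplus>\<^bsub>M\<^esub> b \<odot>\<^bsub>M\<^esub> m"
    using v by (simp add: add_smult_distrib_vec flip: smult add)
  show "a \<odot>\<^bsub>M\<^esub> (m \<oplus>\<^bsub>M\<^esub> m') = a \<odot>\<^bsub>M\<^esub> m \<oplus>\<^bsub>M\<^esub> a \<odot>\<^bsub>M\<^esub> m'"
    using v v' by (simp add: smult_add_distrib_vec[of _ N] flip: smult add)
  show "(a \<otimes>\<^bsub>class_ring\<^esub> b) \<odot>\<^bsub>M\<^esub> m = a \<odot>\<^bsub>M\<^esub> (b \<odot>\<^bsub>M\<^esub> m)"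
    using v by (simp add: smult_smult_assoc flip: smult)
  show "\<one>\<^bsub>class_ring\<^esub> \<odot>\<^bsub>M\<^esub> m = m"
    using v by (simp flip: smult)
qed fact

text \<open>
  Let \<open>B\<close> be the square submatrix with determinant \<open>m\<close>. Then \<open>m v = B (adj B v)\<close>, and the right-hand side is \<open>A w\<close>
  for the vector \<open>w\<close> that places the entries of \<open>adj B v\<close> at the chosen columns and is zero elsewhere.
\<close>
lemma maximal_minor_smult_in_range:
  fixes A :: "'r :: comm_ring_1 mat"
  assumes A: "A \<in> carrier_mat N K" and m: "m \<in> maximal_minors N K A" and v: "v \<in> carrier_vec N"
  shows "\<exists>w\<in>carrier_vec K. m \<cdot>\<^sub>v v = A *\<^sub>v w"
proof -
  obtain J where J: "J \<subseteq> {..<K}" "card J = N" and m: "m = det (submatrix A {..<N} J)"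
    using m unfolding maximal_minors_def by blast
  define B where "B = submatrix A {..<N} J"
  have rows: "{i. i < dim_row A \<and> i \<in> {..<N}} = {..<N}" using A by auto
  have cols: "{j. j < dim_col A \<and> j \<in> J} = J" using A J by auto
  have B: "B \<in> carrier_mat N N"
    unfolding B_def using J(2) by (intro carrier_matI) (simp_all only: dim_submatrix rows cols card_lessThan)
  have pick_row: "pick {..<N} i = i" if "i < N" for i
    using pick_reduce_set[of i N UNIV] that by (simp add: pick_UNIV lessThan_def)
  have finJ: "finite J" using J(1) finite_subset by blast
  have B_index: "B $$ (i, j) = A $$ (i, pick J j)" if "i < N" "j < N" for i j
    unfolding B_def using submatrix_index[of i A "{..<N}" j J] that J(2) pick_row
    by (simp only: rows cols card_lessThan)
  have bij: "bij_betw (pick J) {..<N} J"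
  proof -
    have inj: "inj_on (pick J) {..<N}"
      using J(2) by (intro inj_onI) (metis lessThan_iff less_irrefl nat_neq_iff pick_mono_le)
    moreover have "pick J ` {..<N} \<subseteq> J" using J(2) pick_in_set_le by auto
    moreover have "card (pick J ` {..<N}) = N" using inj by (simp add: card_image)
    ultimately show ?thesis
      using finJ J(2) unfolding bij_betw_def by (simp add: card_subset_eq)
  qed
  define u where "u = adj_mat B *\<^sub>v v"
  have u: "u \<in> carrier_vec N"
    unfolding u_def using adj_mat(1)[OF B] v by (rule mult_mat_vec_carrier)
  define w where "w = vec K (\<lambda>k. if k \<in> J then u $ (inv_into {..<N} (pick J) k) else 0)"
  have w: "w \<in> carrier_vec K" by (simp add: w_def)
  have "A *\<^sub>v w = B *\<^sub>v u"
  proof (rule eq_vecI)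
    fix i assume "i < dim_vec (B *\<^sub>v u)"
    then have i: "i < N" using B by simp
    have "(A *\<^sub>v w) $ i = (\<Sum>k<K. A $$ (i, k) * w $ k)"
      using A w i by (simp add: scalar_prod_def atLeast0LessThan)
    also have "\<dots> = (\<Sum>k\<in>J. A $$ (i, k) * w $ k)"
      using J by (intro sum.mono_neutral_right) (auto simp: w_def)
    also have "\<dots> = (\<Sum>j<N. A $$ (i, pick J j) * w $ pick J j)"
      by (rule sum.reindex_bij_betw[OF bij, symmetric])
    also have "\<dots> = (\<Sum>j<N. B $$ (i, j) * u $ j)"
    proof (rule sum.cong[OF refl])
      fix j assume j: "j \<in> {..<N}"
      then have "pick J j \<in> J" using bij by (auto simp: bij_betw_def)
      then have "w $ pick J j = u $ j"
        using J(1) j bij by (auto simp: w_def bij_betw_def)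
      then show "A $$ (i, pick J j) * w $ pick J j = B $$ (i, j) * u $ j"
        using B_index i j by simp
    qed
    also have "\<dots> = (B *\<^sub>v u) $ i"
      using B u i by (simp add: scalar_prod_def atLeast0LessThan)
    finally show "(A *\<^sub>v w) $ i = (B *\<^sub>v u) $ i" .
  qed (use A B in simp)
  also have "\<dots> = (B * adj_mat B) *\<^sub>v v"
    unfolding u_def using B adj_mat(1)[OF B] v by simp
  also have "\<dots> = m \<cdot>\<^sub>v v"
    unfolding adj_mat(2)[OF B] m B_def[symmetric] using v by (auto intro!: eq_vecI)
  finally show ?thesis using w by metis
qed

section \<open>From integer polynomials to Laurent polynomials\<close>

lemma laurent_monom_add: "laurent_monom (i + j) = laurent_monom i * laurent_monom j"
  by (simp add: mult_single)

lemma laurent_monom_power: "laurent_monom 1 ^ n = laurent_monom (int n)"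
  by (induction n) (simp_all add: mult_single)

lemma single_0_eq_of_int: "Poly_Mapping.single 0 c = (of_int c :: laurent)"
proof -
  have "Poly_Mapping.single 0 (of_int c :: int) = (of_int c :: laurent)" by (rule single_of_int)
  then show ?thesis by simp
qed

text \<open>
  Evaluation at \<open>t\<close> is a ring homomorphism, which gives the homomorphism laws below.
\<close>
lemma laurent_of_poly_eq_poly:
  "laurent_of_poly p = poly (map_poly of_int p) (laurent_monom 1)"
proof -
  let ?q = "map_poly of_int p :: laurent poly"
  have single: "Poly_Mapping.single (int i) c = of_int c * laurent_monom (int i)" for i c
    by (simp only: single_0_eq_of_int[symmetric] mult_single) simp
  have "laurent_of_poly p = (\<Sum>i\<le>degree p. coeff ?q i * laurent_monom 1 ^ i)"
    unfolding laurent_of_poly_def by (simp add: laurent_monom_power coeff_map_poly flip: single)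
  also have "\<dots> = (\<Sum>i\<le>degree ?q. coeff ?q i * laurent_monom 1 ^ i)"
    by (rule sum.mono_neutral_right) (auto simp: degree_map_poly_le intro: coeff_eq_0)
  also have "\<dots> = poly ?q (laurent_monom 1)" by (simp add: poly_altdef)
  finally show ?thesis .
qed

lemma laurent_of_poly_add: "laurent_of_poly (p + q) = laurent_of_poly p + laurent_of_poly q"
  and laurent_of_poly_diff: "laurent_of_poly (p - q) = laurent_of_poly p - laurent_of_poly q"
  and laurent_of_poly_mult: "laurent_of_poly (p * q) = laurent_of_poly p * laurent_of_poly q"
  and laurent_of_poly_prod: "laurent_of_poly (\<Prod>i\<in>S. f i) = (\<Prod>i\<in>S. laurent_of_poly (f i))"
  unfolding laurent_of_poly_eq_poly
  by (simp_all only: of_int_poly_hom.hom_add of_int_poly_hom.hom_minus of_int_poly_hom.hom_mult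
      of_int_poly_hom.hom_prod poly_add poly_diff poly_mult poly_prod)

lemma laurent_of_poly_const: "laurent_of_poly [:n:] = of_int n"
  by (simp add: laurent_of_poly_def single_0_eq_of_int)

lemma laurent_of_poly_monom: "laurent_of_poly (monom 1 n) = laurent_monom (int n)"
  by (simp add: laurent_of_poly_eq_poly map_poly_monom poly_monom laurent_monom_power)

text \<open>
  Negative exponents can be cleared by a monomial, which is a unit.
\<close>
lemma laurent_times_monom_eq_poly:
  "\<exists>k p. laurent_monom (int k) * m = laurent_of_poly p"
  using subset_UNIV[of "Poly_Mapping.keys m"]
proof (induction m rule: frag_induction)
  case zero
  have "laurent_monom (int 0) * 0 = laurent_of_poly 0" by (simp add: laurent_of_poly_def)
  then show ?case by blast
next
  case (one i)
  have "laurent_monom (int (nat (- i))) * frag_of i = laurent_of_poly (monom 1 (nat i))"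
    unfolding laurent_of_poly_monom by (cases "i \<ge> 0") (simp_all add: mult_single)
  then show ?case by blast
next
  case (diff a b)
  then obtain k p l q where a: "laurent_monom (int k) * a = laurent_of_poly p"
    and b: "laurent_monom (int l) * b = laurent_of_poly q" by blast
  have "laurent_monom (int (k + l)) * (a - b)
      = laurent_monom (int l) * (laurent_monom (int k) * a) - laurent_monom (int k) * (laurent_monom (int l) * b)"
    unfolding of_nat_add laurent_monom_add by (simp only: algebra_simps)
  also have "\<dots> = laurent_of_poly (monom 1 l * p - monom 1 k * q)"
    unfolding a b by (simp only: laurent_of_poly_diff laurent_of_poly_mult laurent_of_poly_monom)
  finally show ?case by blast
qed

lemma laurent_cyclotomic_dvd_or_bezout:
  assumes d: "d > 0"
  shows "laurent_of_poly (cyclotomic d) dvd m \<or>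
    (\<exists>u v n. n > (0 :: nat) \<and> u * laurent_of_poly (cyclotomic d) + v * m = of_nat n)"
proof -
  let ?\<Phi> = "laurent_of_poly (cyclotomic d)"
  obtain k p where kp: "laurent_monom (int k) * m = laurent_of_poly p"
    using laurent_times_monom_eq_poly by blast
  from cyclotomic_dvd_or_bezout[OF d, of p] show ?thesis
  proof
    assume "cyclotomic d dvd p"
    then have "?\<Phi> dvd laurent_monom (int k) * m" unfolding kp by (auto simp: laurent_of_poly_mult)
    then have "?\<Phi> dvd laurent_monom (- int k) * (laurent_monom (int k) * m)" by (rule dvd_mult)
    then have "?\<Phi> dvd m" by (simp add: mult_single flip: mult.assoc)
    then show ?thesis ..
  next
    assume "\<exists>u v n. n \<noteq> 0 \<and> u * cyclotomic d + v * p = [:n:]"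
    then obtain u v n where n: "n \<noteq> 0" and uv: "u * cyclotomic d + v * p = [:n:]" by blast
    define U V where "U = laurent_of_poly u" and "V = laurent_of_poly v * laurent_monom (int k)"
    have eq: "U * ?\<Phi> + V * m = of_int n"
      unfolding laurent_of_poly_const[symmetric] uv[symmetric] U_def V_def
      by (simp add: laurent_of_poly_add laurent_of_poly_mult kp mult.assoc)
    have "\<exists>u v n. n > (0 :: nat) \<and> u * ?\<Phi> + v * m = of_nat n"
    proof (cases "n > 0")
      case True
      with eq have "nat n > 0 \<and> U * ?\<Phi> + V * m = of_nat (nat n)" by simp
      then show ?thesis by blast
    next
      case False
      have "(- U) * ?\<Phi> + (- V) * m = - (U * ?\<Phi> + V * m)" by simp
      also have "\<dots> = of_nat (nat (- n))" using False unfolding eq by simp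
      finally have "nat (- n) > 0 \<and> (- U) * ?\<Phi> + (- V) * m = of_nat (nat (- n))" using n False by simp
      then show ?thesis by blast
    qed
    then show ?thesis ..
  qed
qed

lemma laurent_cyclotomic_prod:
  assumes "n > 0"
  shows "laurent_monom (int n) - 1 = (\<Prod>d | d dvd n. laurent_of_poly (cyclotomic d))"
proof -
  have "laurent_monom (int n) - 1 = laurent_of_poly (monom 1 n - [:1:])"
    by (simp add: laurent_of_poly_diff laurent_of_poly_monom laurent_of_poly_const)
  also have "monom 1 n - [:1:] = (\<Prod>d | d dvd n. cyclotomic d)"
    using cyclotomic_prod[OF assms] by (simp add: one_pCons)
  finally show ?thesis by (simp add: laurent_of_poly_prod)
qed

section \<open>Periodicity of the Betti numbers\<close>

text \<open>
  Apply \<open>u h + v m = n\<close> to an element; the second summand vanishes.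
\<close>
lemma divisible_up_to_torsion_of_bezout:
  assumes "cmodule M" and ann: "\<And>a. a \<in> carrier M \<Longrightarrow> m \<odot>\<^bsub>M\<^esub> a = \<zero>\<^bsub>M\<^esub>"
    and n: "n > 0" and bezout: "u * h + v * m = of_nat n"
  shows "divisible_up_to_torsion M h"
  unfolding divisible_up_to_torsion_def
proof (intro exI conjI ballI)
  interpret Module.module class_ring M by fact
  fix a assume a: "a \<in> carrier M"
  have closed: "r \<odot>\<^bsub>M\<^esub> b \<in> carrier M" if "b \<in> carrier M" for r b
    using smult_closed[of r b] that by simp
  have "of_nat n \<odot>\<^bsub>M\<^esub> a = (h * u) \<odot>\<^bsub>M\<^esub> a \<oplus>\<^bsub>M\<^esub> (v * m) \<odot>\<^bsub>M\<^esub> a"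
    using smult_l_distr[of "h * u" "v * m" a] a bezout by (simp add: mult.commute)
  also have "(v * m) \<odot>\<^bsub>M\<^esub> a = \<zero>\<^bsub>M\<^esub>"
    using smult_assoc1[of v m a] smult_r_null[of v] a ann by simp
  also have "(h * u) \<odot>\<^bsub>M\<^esub> a = h \<odot>\<^bsub>M\<^esub> (u \<odot>\<^bsub>M\<^esub> a)"
    using smult_assoc1[of h u a] a by simp
  finally have "of_nat n \<odot>\<^bsub>M\<^esub> a = h \<odot>\<^bsub>M\<^esub> (u \<odot>\<^bsub>M\<^esub> a)"
    using closed a by simp
  then show "\<exists>a'\<in>carrier M. of_nat n \<odot>\<^bsub>M\<^esub> a = h \<odot>\<^bsub>M\<^esub> a'" using closed a by blast
qed (rule n)

text \<open>
  For the second part, \<open>\<Delta>\<close> is divisible by every common divisor of the maximal minors, so some minor is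
  not divisible by the given cyclotomic polynomial; that minor annihilates the module.
\<close>
lemma
  assumes G: "augmented_group G \<chi>" and x: "x \<in> carrier G"
    and \<Delta>: "is_characteristic_polynomial G \<chi> x \<Delta>"
  shows cmodule_augmentation_module: "cmodule (augmentation_module G \<chi> x)"
    and cyclotomic_divisible_up_to_torsion: "d > 0 \<Longrightarrow> \<not> laurent_of_poly (cyclotomic d) dvd \<Delta> \<Longrightarrow>
      divisible_up_to_torsion (augmentation_module G \<chi> x) (laurent_of_poly (cyclotomic d))"
proof -
  let ?M = "augmentation_module G \<chi> x"
  obtain N K A where A: "A \<in> carrier_mat N K"
    and iso: "module_isomorphic class_ring ?M (cokernel_module N K A)"
    and gcd: "\<And>c. (\<forall>m\<in>maximal_minors N K A. c dvd m) \<Longrightarrow> c dvd \<Delta>"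
    using \<Delta> unfolding is_characteristic_polynomial_def by blast
  have M: "abelian_group ?M" by (rule abelian_group_augmentation_module[OF G])
  obtain \<phi> where surj: "\<phi> ` carrier_vec N = carrier ?M"
    and add: "\<And>u v. u \<in> carrier_vec N \<Longrightarrow> v \<in> carrier_vec N \<Longrightarrow> \<phi> (u + v) = \<phi> u \<oplus>\<^bsub>?M\<^esub> \<phi> v"
    and smult: "\<And>a v. v \<in> carrier_vec N \<Longrightarrow> \<phi> (a \<cdot>\<^sub>v v) = a \<odot>\<^bsub>?M\<^esub> \<phi> v"
    and zero: "\<And>w. w \<in> carrier_vec K \<Longrightarrow> \<phi> (A *\<^sub>v w) = \<zero>\<^bsub>?M\<^esub>"
    using cokernel_presentation[OF M augmentation_module_smult_closed[OF G x] A iso] by metis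
  show mod: "cmodule ?M" using M surj add smult by (rule cmodule_of_surjection)
  assume d: "d > 0" and "\<not> laurent_of_poly (cyclotomic d) dvd \<Delta>"
  then obtain m where m: "m \<in> maximal_minors N K A" "\<not> laurent_of_poly (cyclotomic d) dvd m"
    using gcd by blast
  have ann: "m \<odot>\<^bsub>?M\<^esub> a = \<zero>\<^bsub>?M\<^esub>" if "a \<in> carrier ?M" for a
  proof -
    obtain v where v: "v \<in> carrier_vec N" "a = \<phi> v" using \<open>a \<in> carrier ?M\<close> surj by blast
    obtain w where "w \<in> carrier_vec K" "m \<cdot>\<^sub>v v = A *\<^sub>v w"
      using maximal_minor_smult_in_range[OF A m(1) v(1)] by blast
    then show ?thesis using zero smult[OF v(1), of m] v(2) by simp
  qed
  obtain u v n where "n > (0 :: nat)" "u * laurent_of_poly (cyclotomic d) + v * m = of_nat n"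
    using laurent_cyclotomic_dvd_or_bezout[OF d, of m] m(2) by blast
  then show "divisible_up_to_torsion ?M (laurent_of_poly (cyclotomic d))"
    using divisible_up_to_torsion_of_bezout[OF mod ann] by blast
qed

text \<open>
  In the factorization \<open>t^n - 1 = g * h\<close> every factor of \<open>h\<close> acts surjectively on the module up to bounded
  torsion, hence so does \<open>h\<close>, and only \<open>g\<close> is seen by the rank.
\<close>
lemma betti_number_eq:
  assumes G: "augmented_group G \<chi>" and x: "x \<in> carrier G"
    and \<Delta>: "is_characteristic_polynomial G \<chi> x \<Delta>" and n: "n > 0"
  defines "M \<equiv> augmentation_module G \<chi> x"
    and "g \<equiv> \<Prod>d | d dvd n \<and> laurent_of_poly (cyclotomic d) dvd \<Delta>. laurent_of_poly (cyclotomic d)"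
  shows "betti_number G \<chi> x n = ab_group_rank (add_monoid (quotient_module M ((\<lambda>m. g \<odot>\<^bsub>M\<^esub> m) ` carrier M)))"
proof -
  define h where "h = (\<Prod>d | d dvd n \<and> \<not> laurent_of_poly (cyclotomic d) dvd \<Delta>. laurent_of_poly (cyclotomic d))"
  let ?S = "{d. d dvd n}" and ?T = "{d. laurent_of_poly (cyclotomic d) dvd \<Delta>}"
  have "finite ?S" using n by simp
  then have "(\<Prod>d\<in>?S. laurent_of_poly (cyclotomic d))
      = (\<Prod>d\<in>?S \<inter> ?T. laurent_of_poly (cyclotomic d)) * (\<Prod>d\<in>?S - ?T. laurent_of_poly (cyclotomic d))"
    by (rule prod.Int_Diff)
  then have "laurent_monom (int n) - 1 = g * h"
    unfolding laurent_cyclotomic_prod[OF n] g_def h_def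
    by (simp only: Collect_conj_eq set_diff_eq mem_Collect_eq)
  moreover have "divisible_up_to_torsion M h"
    unfolding h_def M_def using n cyclotomic_divisible_up_to_torsion[OF G x \<Delta>] cmodule_augmentation_module[OF G x \<Delta>]
    by (intro divisible_up_to_torsion_prod) (auto intro: dvd_pos_nat)
  moreover have "cmodule M" unfolding M_def by (rule cmodule_augmentation_module[OF G x \<Delta>])
  ultimately show ?thesis
    using rank_quotient_smult_eq[of M h g] by (simp add: betti_number_def M_def Let_def)
qed

theorem proposition2p2:
  fixes G :: "('g, 'b) monoid_scheme" and \<chi> :: "'g \<Rightarrow> int" and x :: 'g
    and \<Delta> :: laurent and r :: nat
  assumes "augmented_group G \<chi>"
    and "x \<in> carrier G" and "\<chi> x = 1"
    and "is_characteristic_polynomial G \<chi> x \<Delta>"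
    and "r > 0"
  shows "betti_number G \<chi> x (r + cyclotomic_order \<Delta>) = betti_number G \<chi> x r"
proof -
  have "d dvd r + cyclotomic_order \<Delta> \<longleftrightarrow> d dvd r"
    if "d > 0" "laurent_of_poly (cyclotomic d) dvd \<Delta>" for d
  proof -
    have "d dvd cyclotomic_order \<Delta>"
      unfolding cyclotomic_order_def using that by (intro dvd_Lcm) simp
    then show ?thesis by (simp add: dvd_add_left_iff)
  qed
  then have "{d. d dvd r + cyclotomic_order \<Delta> \<and> laurent_of_poly (cyclotomic d) dvd \<Delta>}
      = {d. d dvd r \<and> laurent_of_poly (cyclotomic d) dvd \<Delta>}"
    using \<open>r > 0\<close> by (metis (no_types, lifting) add_gr_0 dvd_pos_nat)
  then show ?thesis
    using assms by (simp add: betti_number_eq)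
qed

end
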